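(* Let $R>0$ and let $\Phi$ be real-analytic on $(-R,R)$. Let $f=f(x,v)\in L^1_{\rm loc}(\mathbb{R}_x\times\mathbb{R}_v)$ be $C^1$ on $\{v<0\}\cup\{v>0\}$, with $f(x,\cdot)\in L^1(\mathbb{R}_v)$ for every $x$, and with $\rho(x)=\int f(x,v)\,dv$ of class $C^1(\mathbb{R})$ with values in $(-R,R)$. Put $H(x,v)=\frac{v^2}{2}+\Phi(\rho(x))$. Then $f$ is a weak stationary state if and only if the following hold: (i) There exist families of functions $\{F_k\}_{k\in\mathbb{N}}$ and $\{G_k\}_{k\in\mathbb{N}}$ such that, for all $x\in\mathbb{R}$, $$f(x,v)=\begin{cases}F_{K(x,H(x,v))}\bigl(H(x,v)\bigr), & v>0,\\ G_{K(x,H(x,v))}\bigl(H(x,v)\bigr), & v<0.\end{cases}$$ (ii) For every $x\in\mathbb{R}$, $$\rho(x)=\int_0^\infty F_{K\left(x,\frac{v^2}{2}+\Phi(\rho(x))\right)}\Bigl(\frac{v^2}{2}+\Phi(\rho(x))\Bigr)dv+\int_0^\infty G_{K\left(x,\frac{v^2}{2}+\Phi(\rho(x))\right)}\Bigl(\frac{v^2}{2}+\Phi(\rho(x))\Bigr)dv .$$ (iii) For a.e. $x\in\mathbb{R}$, $$\lim_{v\to0^+}\partial_x\Phi(\rho(x))\,F_{K(x,H(x,v))}(H(x,v))=\lim_{v\to0^-}\partial_x\Phi(\rho(x))\,G_{K(x,H(x,v))}(H(x,v)).$$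
   Context: Real-analytic on $(-R,R)$: $\Phi(z)=\sum_{n\ge0}c_nz^n$ for all $|z|<R$, with real $c_n$. Weak stationary state: a function $f\in L^1_{\rm loc}(\mathbb{R}_x\times\mathbb{R}_v)$ is a weak stationary state (of the equation $\partial_tf+v\partial_xf-\partial_x\Phi(\rho)\partial_vf=0$, $\rho=\int f\,dv$) if $f(x,\cdot)\in L^1(\mathbb{R}_v)$ for a.e. $x$, $\Phi(\rho)\in W^{1,\infty}_{\rm loc}(\mathbb{R})$, and $v\,\partial_xf-\partial_x\Phi(\rho)\,\partial_vf=0$ holds in the sense of distributions on $\mathbb{R}^2$. Components: for $h\in\mathbb{R}$ let $A(h)=\{x\in\mathbb{R}:\Phi(\rho(x))<h\}$, an open subset of $\mathbb{R}$. Its connected components (disjoint open intervals, at most countably many) are enumerated as $\{E_k(h)\}_{k\in I(h)}$ with $I(h)\subseteq\mathbb{N}$ (an enumeration fixed for each $h$). For $x\in A(h)$, $K(x,h)\in I(h)$ is the unique index with $x\in E_{K(x,h)}(h)$. Note $x\in A(H(x,v))$ whenever $v\ne0$. The value $F_k(h)$ (or $G_k(h)$) is only relevant for those $h$ with $k\in I(h)$. *)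

theory Defs
  imports "HOL-Analysis.Analysis"
begin

text \<open>All measure-theoretic notions refer to the completed Lebesgue measure \<^const>\<open>lebesgue\<close>,
  on the line or on the plane.\<close>

definition real_analytic_power_series :: "real \<Rightarrow> (real \<Rightarrow> real) \<Rightarrow> bool" where
  "real_analytic_power_series R \<Phi> \<longleftrightarrow>
     (\<exists>c :: nat \<Rightarrow> real. \<forall>z. \<bar>z\<bar> < R \<longrightarrow> (\<lambda>n. c n * z ^ n) sums \<Phi> z)"

text \<open>Only meaningful for open \<open>S\<close>: the derivative is the full (two-sided) Frechet derivative, and
  the directional derivatives \<open>e\<close> range over the whole space.\<close>

fun Ck_on :: "nat \<Rightarrow> 'a::euclidean_space set \<Rightarrow> ('a \<Rightarrow> real) \<Rightarrow> bool" where
  "Ck_on 0 S u \<longleftrightarrow> continuous_on S u"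
| "Ck_on (Suc n) S u \<longleftrightarrow>
     (\<forall>p\<in>S. u differentiable (at p)) \<and> (\<forall>e. Ck_on n S (\<lambda>p. frechet_derivative u (at p) e))"

definition test_function :: "('a::euclidean_space \<Rightarrow> real) \<Rightarrow> bool" where
  "test_function \<phi> \<longleftrightarrow> (\<forall>n. Ck_on n UNIV \<phi>) \<and> compact (closure {p. \<phi> p \<noteq> 0})"

definition L1_loc :: "('a::euclidean_space \<Rightarrow> real) \<Rightarrow> bool" where
  "L1_loc u \<longleftrightarrow> (\<forall>C. compact C \<longrightarrow> u absolutely_integrable_on C)"

definition Linf_loc :: "(real \<Rightarrow> real) \<Rightarrow> bool" where
  "Linf_loc u \<longleftrightarrow> u \<in> borel_measurable lebesgue \<and>
     (\<forall>C. compact C \<longrightarrow> (\<exists>B. AE x in lebesgue. x \<in> C \<longrightarrow> \<bar>u x\<bar> \<le> B))"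

definition weak_derivative :: "(real \<Rightarrow> real) \<Rightarrow> (real \<Rightarrow> real) \<Rightarrow> bool" where
  "weak_derivative u g \<longleftrightarrow>
     (\<forall>\<phi>. test_function \<phi> \<longrightarrow>
        (LINT x|lebesgue. u x * deriv \<phi> x) = - (LINT x|lebesgue. g x * \<phi> x))"

definition rho :: "(real \<Rightarrow> real \<Rightarrow> real) \<Rightarrow> real \<Rightarrow> real" where
  "rho f x = (LINT v|lebesgue. f x v)"

definition potential :: "(real \<Rightarrow> real) \<Rightarrow> (real \<Rightarrow> real \<Rightarrow> real) \<Rightarrow> real \<Rightarrow> real" where
  "potential \<Phi> f x = \<Phi> (rho f x)"

text \<open>The condition that the potential lies in \<open>W\<^sup>1\<^sup>,\<^sup>\<infinity>\<close> locally is its membership in local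
  \<open>L\<^sup>\<infinity>\<close> together with the existence of a weak derivative \<open>g\<close> there; \<open>g\<close> is unique up to null sets, so
  it may be shared with the equation. As neither \<open>v\<close> depends on \<open>x\<close> nor \<open>g\<close> on \<open>v\<close>, the distribution
  \<open>v \<partial>\<^sub>x f - g \<partial>\<^sub>v f\<close> is \<open>\<partial>\<^sub>x (v f) - \<partial>\<^sub>v (g f)\<close>, and moving the derivatives to the test function gives
  the integral below (up to sign).\<close>

definition weak_stationary_state :: "(real \<Rightarrow> real) \<Rightarrow> (real \<Rightarrow> real \<Rightarrow> real) \<Rightarrow> bool" where
  "weak_stationary_state \<Phi> f \<longleftrightarrow>
     L1_loc (\<lambda>(x, v). f x v) \<and>
     (AE x in lebesgue. integrable lebesgue (f x)) \<and>
     Linf_loc (potential \<Phi> f) \<and>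
     (\<exists>g. Linf_loc g \<and> weak_derivative (potential \<Phi> f) g \<and>
        (\<forall>\<phi> :: real \<times> real \<Rightarrow> real. test_function \<phi> \<longrightarrow>
           (LINT (x, v)|lebesgue.
              f x v * (v * deriv (\<lambda>s. \<phi> (s, v)) x - g x * deriv (\<lambda>w. \<phi> (x, w)) v)) = 0))"

definition hamiltonian :: "(real \<Rightarrow> real) \<Rightarrow> (real \<Rightarrow> real \<Rightarrow> real) \<Rightarrow> real \<Rightarrow> real \<Rightarrow> real" where
  "hamiltonian \<Phi> f x v = v\<^sup>2 / 2 + potential \<Phi> f x"

definition sublevel :: "(real \<Rightarrow> real) \<Rightarrow> (real \<Rightarrow> real \<Rightarrow> real) \<Rightarrow> real \<Rightarrow> real set" where
  "sublevel \<Phi> f h = {x. potential \<Phi> f x < h}"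

definition enumerates_components ::
  "(real \<Rightarrow> real set) \<Rightarrow> (real \<Rightarrow> nat set) \<Rightarrow> (real \<Rightarrow> nat \<Rightarrow> real set) \<Rightarrow> bool" where
  "enumerates_components A I E \<longleftrightarrow> (\<forall>h. bij_betw (E h) (I h) (components (A h)))"

definition component_index ::
  "(real \<Rightarrow> nat set) \<Rightarrow> (real \<Rightarrow> nat \<Rightarrow> real set) \<Rightarrow> real \<Rightarrow> real \<Rightarrow> nat" where
  "component_index I E x h = (THE k. k \<in> I h \<and> x \<in> E h k)"

lemma component_index_unique:
  assumes "enumerates_components A I E" "x \<in> A h"
  shows "\<exists>!k. k \<in> I h \<and> x \<in> E h k"
proof -
  have b: "bij_betw (E h) (I h) (components (A h))"
    using assms(1) by (simp add: enumerates_components_def)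
  obtain C where C: "C \<in> components (A h)" "x \<in> C"
    using assms(2) Union_components by (metis UnionE)
  then obtain k where k: "k \<in> I h" "E h k = C"
    using b by (metis bij_betw_imp_surj_on imageE)
  have "j = k" if "j \<in> I h" "x \<in> E h j" for j
  proof -
    have "E h j \<in> components (A h)" using b that(1) by (metis bij_betwE)
    then have "E h j = E h k"
      using C k that(2) components_nonoverlap by (metis disjoint_iff)
    then show ?thesis using b k(1) that(1) by (metis bij_betw_def inj_onD)
  qed
  then show ?thesis using k C by blast
qed

end

(*
Write U = Phi(rho), which is C^1.  Away from v = 0 the weak equation is the pointwise transport equation
v f_x = U' f_v, whose characteristics are the curves v = +-sqrt (2 (h - U)) over a component of {U < h};
so f depends only on the sign of v, on h and on the component, which is (i), and (ii) is (i) integrated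
in v.  Near a point x0 with U' x0 ~= 0 the two halves of f extend smoothly up to v = 0, and Green's
formula on a box that crosses v = 0 leaves only the jump of U' f, which must therefore vanish: this is (iii).

Conversely, (i) and (iii) give the weak equation without any bound on f near v = 0: substitute
h = v^2/2 + U x in the v-integral and integrate in x first.  For fixed h the integrand is then the
x-derivative of F phi(x, w) - G phi(x, -w), w = sqrt (2 (h - U x)), with F and G constant on each
component of {U < h}; the boundary terms at a turning point e are (F - G) phi(e, 0).  By Sard's theorem,
for almost every h every turning point has U' e ~= 0 and satisfies the limit in (iii), hence F = G.
*)
theory Submission
  imports Defs
begin

section \<open>Smooth bumps\<close>

text \<open>The obstacle is the line v = 0, near which \<open>f\<close> may be unbounded. Cutting
  out a strip |v| < eps would leave boundary terms built from U'(x) f(x, eps) and U'(x) f(x, -eps);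
  condition (iii) makes their difference tend to 0 for almost every x, but nothing dominates it, so
  the limit cannot be taken under the integral. On an energy slice no such limit is needed, because
  \<open>f\<close> is constant on each of the two branches that meet at a turning point. The
  critical points of U may have positive measure on the line; only their image under U is null, so
  the exceptional sets have to be sets of energies and not of positions. The interchange of
  integrals costs only the local integrability of \<open>f\<close>. In the other direction, the
  traces of \<open>f\<close> at v = 0 are regular because both halves are read off at a point
  downhill of x0, where the speeds at the relevant energies stay away from 0. Test functions have to
  be smooth to all orders with compact support; explicit ones are built from exp (-1/t).\<close>

definition flat :: "nat \<Rightarrow> real \<Rightarrow> real" where
  "flat k t = (if t > 0 then exp (- 1 / t) / t ^ k else 0)"

lemma flat_tendsto_0: "(flat k \<longlongrightarrow> 0) (at 0)"
proof -
  have "((\<lambda>y. y ^ k / exp y) \<longlongrightarrow> (0::real)) at_top"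
    by (rule tendsto_power_div_exp_0)
  then have "((\<lambda>t. inverse t ^ k / exp (inverse t)) \<longlongrightarrow> (0::real)) (at_right 0)"
    by (rule filterlim_compose[OF _ filterlim_inverse_at_top_right])
  then have "(flat k \<longlongrightarrow> 0) (at_right 0)"
    by (rule Lim_transform_eventually)
      (auto simp: eventually_at_filter flat_def exp_minus field_simps inverse_eq_divide)
  moreover have "(flat k \<longlongrightarrow> 0) (at_left 0)"
    by (rule tendsto_eventually) (auto simp: eventually_at_filter flat_def)
  ultimately show ?thesis
    using filterlim_split_at_real by blast
qed

text \<open>The index \<open>k\<close> exists for this formula: differentiating exp (-1/t) produces
  powers of 1/t, and with these powers the family is closed under differentiation up to linear
  combinations. At t = 0 the difference quotient of \<open>flat k\<close> is
  \<open>flat (k + 1)\<close>, which tends to 0.\<close>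

lemma flat_has_derivative:
  "(flat k has_real_derivative flat (k + 2) t - real k * flat (k + 1) t) (at t)"
proof -
  consider "t > 0" | "t < 0" | "t = 0" by linarith
  then show ?thesis
  proof cases
    case 1
    have "((\<lambda>t. exp (- 1 / t) / t ^ k) has_real_derivative
        flat (k + 2) t - real k * flat (k + 1) t) (at t)"
    proof (rule DERIV_cong)
      have "((\<lambda>t. exp (- 1 / t)) has_real_derivative exp (- 1 / t) * (1 / t\<^sup>2)) (at t)"
        using 1 by (auto intro!: derivative_eq_intros simp: power2_eq_square)
      then show "((\<lambda>t. exp (- 1 / t) / t ^ k) has_real_derivative
          (exp (- 1 / t) * (1 / t\<^sup>2) * t ^ k - exp (- 1 / t) * (real k * t ^ (k - 1)))
            / (t ^ k * t ^ k)) (at t)"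
        by (rule DERIV_divide) (use 1 DERIV_pow[of k t] in auto)
      show "(exp (- 1 / t) * (1 / t\<^sup>2) * t ^ k - exp (- 1 / t) * (real k * t ^ (k - 1)))
            / (t ^ k * t ^ k) = flat (k + 2) t - real k * flat (k + 1) t"
        using 1 by (cases k) (simp_all add: flat_def divide_simps, simp_all add: algebra_simps power2_eq_square)
    qed
    then show ?thesis
      by (rule DERIV_cong_ev[THEN iffD1, rotated 3])
        (use 1 eventually_nhds_in_open[of "{0<..}" t] in
          \<open>auto simp: flat_def elim!: eventually_mono\<close>)
  next
    case 2
    have "((\<lambda>t. 0) has_real_derivative flat (k + 2) t - real k * flat (k + 1) t) (at t)"
      using 2 by (auto simp: flat_def)
    then show ?thesis
      by (rule DERIV_cong_ev[THEN iffD1, rotated 3])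
        (use 2 eventually_nhds_in_open[of "{..<0}" t] in
          \<open>auto simp: flat_def elim!: eventually_mono\<close>)
  next
    case 3
    have "((\<lambda>h. flat k h / h) \<longlongrightarrow> 0) (at 0)"
      by (rule Lim_transform_eventually[OF flat_tendsto_0[of "k + 1"]])
        (auto simp: eventually_at_filter flat_def field_simps)
    then show ?thesis
      using 3 by (simp add: DERIV_def flat_def)
  qed
qed

lemma flat_bounds: "0 \<le> flat 0 t" "flat 0 t \<le> 1"
  by (auto simp: flat_def)

lemma flat_pos_iff: "0 < flat 0 t \<longleftrightarrow> 0 < t"
  by (auto simp: flat_def)

text \<open>Closed under directional derivatives, hence consisting of smooth functions.\<close>

inductive_set flat_algebra :: "('a::euclidean_space \<Rightarrow> real) set" where
  flat: "(\<lambda>p. flat k (c + p \<bullet> b)) \<in> flat_algebra"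
| const: "(\<lambda>p. c) \<in> flat_algebra"
| add: "u \<in> flat_algebra \<Longrightarrow> w \<in> flat_algebra \<Longrightarrow> (\<lambda>p. u p + w p) \<in> flat_algebra"
| mult: "u \<in> flat_algebra \<Longrightarrow> w \<in> flat_algebra \<Longrightarrow> (\<lambda>p. u p * w p) \<in> flat_algebra"

lemma flat_algebra_derivative:
  "u \<in> flat_algebra \<Longrightarrow>
    \<exists>D. (\<forall>p. (u has_derivative D p) (at p)) \<and> (\<forall>e. (\<lambda>p. D p e) \<in> flat_algebra)"
proof (induction rule: flat_algebra.induct)
  case (flat k c b)
  let ?d = "\<lambda>t. flat (k + 2) t - real k * flat (k + 1) t"
  let ?D = "\<lambda>p e. ?d (c + p \<bullet> b) * (e \<bullet> b)"
  have D: "((\<lambda>p. flat k (c + p \<bullet> b)) has_derivative ?D p) (at p)" for p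
  proof -
    have "((\<lambda>p. c + p \<bullet> b) has_derivative (\<lambda>e. e \<bullet> b)) (at p)"
      by (auto intro!: derivative_eq_intros)
    from DERIV_compose_FDERIV[OF flat_has_derivative this, of k]
    show ?thesis by (simp add: mult.commute)
  qed
  have eq: "?D p e = (flat (k + 2) (c + p \<bullet> b) + (- real k) * flat (k + 1) (c + p \<bullet> b)) * (e \<bullet> b)" for p e
    by simp
  have "(\<lambda>p. ?D p e) \<in> flat_algebra" for e
    unfolding eq by (intro flat_algebra.intros)
  with D show ?case by (intro exI[of _ ?D]) auto
next
  case (const c)
  show ?case
    by (intro exI[of _ "\<lambda>p e. 0"]) (auto intro: flat_algebra.const)
next
  case (add u w)
  then obtain D D' where "\<forall>p. (u has_derivative D p) (at p)" "\<forall>e. (\<lambda>p. D p e) \<in> flat_algebra"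
    "\<forall>p. (w has_derivative D' p) (at p)" "\<forall>e. (\<lambda>p. D' p e) \<in> flat_algebra" by blast
  then show ?case
    by (intro exI[of _ "\<lambda>p e. D p e + D' p e"])
      (auto intro!: flat_algebra.add derivative_eq_intros)
next
  case (mult u w)
  then obtain D D' where D: "\<forall>p. (u has_derivative D p) (at p)" "\<forall>e. (\<lambda>p. D p e) \<in> flat_algebra"
    "\<forall>p. (w has_derivative D' p) (at p)" "\<forall>e. (\<lambda>p. D' p e) \<in> flat_algebra" by blast
  have "((\<lambda>p. u p * w p) has_derivative (\<lambda>e. u p * D' p e + D p e * w p)) (at p)" for p
    using D by (auto intro!: derivative_eq_intros)
  then show ?case
    using D mult
    by (intro exI[of _ "\<lambda>p e. u p * D' p e + D p e * w p"])
      (auto intro!: flat_algebra.add flat_algebra.mult)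
qed

lemma flat_algebra_Ck_on: "u \<in> flat_algebra \<Longrightarrow> Ck_on n UNIV u"
proof (induction n arbitrary: u)
  case 0
  then show ?case
    using flat_algebra_derivative[OF 0]
    by (auto intro!: continuous_at_imp_continuous_on intro: has_derivative_continuous)
next
  case (Suc n)
  obtain D where D: "\<forall>p. (u has_derivative D p) (at p)" "\<forall>e. (\<lambda>p. D p e) \<in> flat_algebra"
    using flat_algebra_derivative[OF Suc.prems] by blast
  have "frechet_derivative u (at p) = D p" for p
    using D(1) frechet_derivative_at by metis
  then show ?case
    using D Suc.IH by (auto simp: differentiable_def)
qed

text \<open>The scale \<open>m\<close> serves two purposes: with \<open>m = 1\<close> this is a
  fixed test function that is positive exactly on the open interval, and as \<open>m\<close> grows
  it approximates the indicator of that interval.\<close>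

definition bump :: "real \<Rightarrow> real \<Rightarrow> real \<Rightarrow> real \<Rightarrow> real" where
  "bump m a b x = flat 0 (m * (x - a)) * flat 0 (m * (b - x))"

lemma bump_nonneg: "0 \<le> bump m a b x"
  by (simp add: bump_def flat_bounds)

lemma bump_le_1: "bump m a b x \<le> 1"
  unfolding bump_def using mult_mono[OF flat_bounds(2) flat_bounds(2)] flat_bounds(1) by fastforce

lemma bump_pos_iff: "m > 0 \<Longrightarrow> 0 < bump m a b x \<longleftrightarrow> a < x \<and> x < b"
  by (auto simp: bump_def zero_less_mult_iff flat_pos_iff flat_bounds[THEN leD])

lemma bump_eq_0: "m > 0 \<Longrightarrow> x \<le> a \<or> b \<le> x \<Longrightarrow> bump m a b x = 0"
  using bump_pos_iff[of m a b x] bump_nonneg[of m a b x] by linarith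

lemma bump_support: "m > 0 \<Longrightarrow> bump m a b x \<noteq> 0 \<Longrightarrow> a < x \<and> x < b"
  by (metis bump_eq_0 not_le)

lemma bump_tendsto: "(\<lambda>n. bump (real n) a b x) \<longlonglongrightarrow> indicator {a<..<b} x"
proof (cases "a < x \<and> x < b")
  case True
  have *: "(\<lambda>n. flat 0 (real n * c)) \<longlonglongrightarrow> 1" if "c > 0" for c
  proof -
    have "(\<lambda>n. exp (- (1 / c) * inverse (real n))) \<longlonglongrightarrow> exp (- (1 / c) * 0)"
      by (intro tendsto_intros lim_inverse_n)
    then have "(\<lambda>n. exp (- (1 / c) * inverse (real n))) \<longlonglongrightarrow> 1" by simp
    then show ?thesis
      by (rule Lim_transform_eventually)
        (use that in \<open>auto simp: flat_def field_simps intro!: eventually_sequentiallyI[of 1]\<close>)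
  qed
  show ?thesis
    using tendsto_mult[OF *[of "x - a"] *[of "b - x"]] True by (simp add: bump_def)
next
  case False
  have "bump (real n) a b x = 0" for n
    using bump_eq_0[of n x a b] False by (cases n) (auto simp: bump_def flat_def)
  then show ?thesis using False by (auto simp: indicator_def)
qed

lemma bump_flat_algebra:
  assumes "e \<in> (Basis :: 'a::euclidean_space set)"
  shows "(\<lambda>p. bump m a b (p \<bullet> e)) \<in> flat_algebra"
proof -
  have "(\<lambda>p. bump m a b (p \<bullet> e))
      = (\<lambda>p. flat 0 (- (m * a) + p \<bullet> (m *\<^sub>R e)) * flat 0 (m * b + p \<bullet> (- m *\<^sub>R e)))"
    by (auto simp: bump_def algebra_simps)
  then show ?thesis by (simp only: flat_algebra.flat flat_algebra.mult)
qed

lemma test_function_bump: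
  assumes "m > 0"
  shows "test_function (bump m a b)"
proof -
  have "bump m a b \<in> flat_algebra"
    using bump_flat_algebra[of "1::real" m a b] by simp
  moreover have "bounded {p. bump m a b p \<noteq> 0}"
  proof (rule bounded_subset[OF bounded_cbox[of a b]], rule subsetI)
    fix x assume "x \<in> {p. bump m a b p \<noteq> 0}"
    then show "x \<in> cbox a b" using bump_support[OF assms, of a b x] by auto
  qed
  ultimately show ?thesis
    by (simp add: test_function_def flat_algebra_Ck_on compact_closure)
qed

lemma test_function_bump_prod:
  assumes "m > 0"
  shows "test_function (\<lambda>p::real\<times>real. bump m a b (fst p) * bump m c d (snd p))"
proof -
  have "(\<lambda>p::real\<times>real. bump m a b (fst p)) \<in> flat_algebra"
    "(\<lambda>p::real\<times>real. bump m c d (snd p)) \<in> flat_algebra"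
    using bump_flat_algebra[of "(1::real, 0::real)" m a b]
      bump_flat_algebra[of "(0::real, 1::real)" m c d]
    by (simp_all add: Basis_prod_def inner_prod_def)
  then have "(\<lambda>p::real\<times>real. bump m a b (fst p) * bump m c d (snd p)) \<in> flat_algebra"
    by (rule flat_algebra.mult)
  moreover have "bounded {p::real\<times>real. bump m a b (fst p) * bump m c d (snd p) \<noteq> 0}"
  proof (rule bounded_subset[OF bounded_cbox[of "(a, c)" "(b, d)"]], rule subsetI)
    fix p :: "real \<times> real" assume "p \<in> {p. bump m a b (fst p) * bump m c d (snd p) \<noteq> 0}"
    then show "p \<in> cbox (a, c) (b, d)"
      using bump_support[OF assms, of a b "fst p"] bump_support[OF assms, of c d "snd p"]
      by (cases p) (auto simp: cbox_Pair_eq)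
  qed
  ultimately show ?thesis
    by (simp add: test_function_def flat_algebra_Ck_on compact_closure)
qed

section \<open>Test functions and weak derivatives\<close>

lemma compact_support_bound:
  fixes F :: "'a::euclidean_space \<Rightarrow> real"
  assumes "continuous_on UNIV F" and "\<And>p. p \<notin> cbox a b \<Longrightarrow> F p = 0"
  obtains B where "\<And>p. \<bar>F p\<bar> \<le> B"
proof -
  have "compact (F ` cbox a b)"
    by (intro compact_continuous_image compact_cbox continuous_on_subset[OF assms(1)]) auto
  then obtain B where B: "\<forall>p\<in>cbox a b. \<bar>F p\<bar> \<le> B"
    by (auto dest!: compact_imp_bounded simp: bounded_iff)
  have "\<bar>F p\<bar> \<le> max B 0" for p
    by (cases "p \<in> cbox a b") (use B assms(2) in \<open>force+\<close>)
  then show thesis by (rule that)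
qed

text \<open>A bridge from Lebesgue integrals over the whole space, in which the weak equation is
  stated, to gauge integrals over a box, where the fundamental theorem of calculus applies.\<close>

lemma lebesgue_integral_box_support:
  fixes F :: "'a::euclidean_space \<Rightarrow> real"
  assumes "F absolutely_integrable_on cbox a b" and "\<And>p. p \<notin> cbox a b \<Longrightarrow> F p = 0"
  shows "integrable lebesgue F" and "(LINT p|lebesgue. F p) = integral (cbox a b) F"
proof -
  have eq: "(\<lambda>p. indicator (cbox a b) p *\<^sub>R F p) = F"
    using assms(2) by (fastforce simp: indicator_def)
  show "integrable lebesgue F"
    using assms(1) unfolding set_integrable_def eq .
  show "(LINT p|lebesgue. F p) = integral (cbox a b) F"
    using set_lebesgue_integral_eq_integral(2)[OF assms(1)]
    unfolding set_lebesgue_integral_def eq .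
qed

lemma lebesgue_integral_continuous_box_support:
  fixes F :: "'a::euclidean_space \<Rightarrow> real"
  assumes "continuous_on UNIV F" and "\<And>p. p \<notin> cbox a b \<Longrightarrow> F p = 0"
  shows "integrable lebesgue F" and "(LINT p|lebesgue. F p) = integral (cbox a b) F"
  using lebesgue_integral_box_support[where F = F and a = a and b = b] assms
  by (auto intro!: absolutely_integrable_continuous continuous_on_subset[OF assms(1)])

lemma test_function_support_box:
  fixes \<phi> :: "'a::euclidean_space \<Rightarrow> real"
  assumes "test_function \<phi>"
  obtains a b where "{p. \<phi> p \<noteq> 0} \<subseteq> box a b"
proof -
  have "bounded (closure {p. \<phi> p \<noteq> 0})"
    using assms by (auto simp: test_function_def intro: compact_imp_bounded)
  then have "bounded {p. \<phi> p \<noteq> 0}"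
    using bounded_subset closure_subset by blast
  then show thesis
    using bounded_subset_box_symmetric that by metis
qed

lemma test_function_frechet:
  assumes "test_function \<phi>"
  shows "(\<phi> has_derivative frechet_derivative \<phi> (at p)) (at p)"
    and "continuous_on UNIV (\<lambda>p. frechet_derivative \<phi> (at p) e)"
    and "continuous_on UNIV \<phi>"
proof -
  have "Ck_on 1 UNIV \<phi>" "Ck_on 0 UNIV \<phi>"
    using assms by (simp_all only: test_function_def)
  then show "(\<phi> has_derivative frechet_derivative \<phi> (at p)) (at p)"
    "continuous_on UNIV (\<lambda>p. frechet_derivative \<phi> (at p) e)" "continuous_on UNIV \<phi>"
    by (auto simp: frechet_derivative_works)
qed

section \<open>Derivatives and supports of test functions\<close>

lemma has_derivative_zero_of_locally_zero:
  fixes \<phi> :: "'a::euclidean_space \<Rightarrow> real"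
  assumes "(\<phi> has_derivative D) (at p)" "open S" "p \<in> S" "\<And>q. q \<in> S \<Longrightarrow> \<phi> q = 0"
  shows "D e = 0"
proof -
  have "((\<lambda>q. 0) has_derivative D) (at p)"
    by (rule has_derivative_transform_within_open[OF assms(1-3)]) (simp add: assms(4))
  then have "D = (\<lambda>e. 0)"
    using has_derivative_unique has_derivative_const by blast
  then show ?thesis by simp
qed

lemma test_function_1D:
  fixes \<phi> :: "real \<Rightarrow> real"
  assumes "test_function \<phi>"
  obtains a b where "a < b" "\<And>x. (\<phi> has_real_derivative deriv \<phi> x) (at x)" "continuous_on UNIV (deriv \<phi>)"
    "\<And>x. x \<notin> {a<..<b} \<Longrightarrow> \<phi> x = 0" "\<And>x. x \<notin> {a..b} \<Longrightarrow> deriv \<phi> x = 0"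
proof -
  note F = test_function_frechet[OF assms]
  have D: "(\<phi> has_real_derivative frechet_derivative \<phi> (at x) 1) (at x)" for x
  proof -
    have "frechet_derivative \<phi> (at x) = (\<lambda>e. frechet_derivative \<phi> (at x) 1 * e)"
      using has_derivative_linear[OF F(1)[of x]]
      by (metis (no_types, opaque_lifting) linear_cmul mult.commute mult.right_neutral real_scaleR_def)
    then show ?thesis
      using F(1)[of x] by (simp add: has_field_derivative_def)
  qed
  then have eq: "deriv \<phi> x = frechet_derivative \<phi> (at x) 1" for x
    by (rule DERIV_imp_deriv)
  obtain a b where ab: "{x. \<phi> x \<noteq> 0} \<subseteq> box a b"
    using test_function_support_box[OF assms] by blast
  \<comment> \<open>The support may be empty and the box degenerate; \<open>b'\<close> keeps the
    interval nontrivial in every case.\<close>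
  define b' where "b' = max b (a + 1)"
  show thesis
  proof (rule that[of a b'])
    show "a < b'" by (simp add: b'_def)
    show "(\<phi> has_real_derivative deriv \<phi> x) (at x)" for x using D eq by simp
    show "continuous_on UNIV (deriv \<phi>)"
      using F(2)[of 1] unfolding eq[symmetric] by simp
    show z: "\<phi> x = 0" if "x \<notin> {a<..<b'}" for x
      using ab that by (auto simp: b'_def subset_eq)
    show "deriv \<phi> x = 0" if "x \<notin> {a..b'}" for x
      unfolding eq
      by (rule has_derivative_zero_of_locally_zero[OF F(1), of "- {a..b'}"])
        (use that z in \<open>auto simp: open_Compl\<close>)
  qed
qed

lemma test_function_2D:
  fixes \<phi> :: "real \<times> real \<Rightarrow> real"
  assumes "test_function \<phi>"
  obtains \<phi>x \<phi>v M where "0 < M"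
    "\<And>p. (\<phi> has_derivative (\<lambda>e. fst e * \<phi>x p + snd e * \<phi>v p)) (at p)"
    "continuous_on UNIV \<phi>" "continuous_on UNIV \<phi>x" "continuous_on UNIV \<phi>v"
    "\<And>p. \<bar>fst p\<bar> \<ge> M \<or> \<bar>snd p\<bar> \<ge> M \<Longrightarrow> \<phi> p = 0"
    "\<And>p. \<bar>fst p\<bar> > M \<or> \<bar>snd p\<bar> > M \<Longrightarrow> \<phi>x p = 0"
    "\<And>p. \<bar>fst p\<bar> > M \<or> \<bar>snd p\<bar> > M \<Longrightarrow> \<phi>v p = 0"
    "\<And>x v. deriv (\<lambda>s. \<phi> (s, v)) x = \<phi>x (x, v)"
    "\<And>x v. deriv (\<lambda>w. \<phi> (x, w)) v = \<phi>v (x, v)"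
proof -
  note F = test_function_frechet[OF assms]
  define \<phi>x where "\<phi>x = (\<lambda>p. frechet_derivative \<phi> (at p) (1, 0))"
  define \<phi>v where "\<phi>v = (\<lambda>p. frechet_derivative \<phi> (at p) (0, 1))"
  have eq: "frechet_derivative \<phi> (at p) = (\<lambda>e. fst e * \<phi>x p + snd e * \<phi>v p)" for p
  proof
    fix e :: "real \<times> real"
    have lin: "linear (frechet_derivative \<phi> (at p))"
      using has_derivative_linear[OF F(1)] .
    have "e = fst e *\<^sub>R (1, 0) + snd e *\<^sub>R (0, 1)"
      by (simp add: prod_eq_iff)
    then have "frechet_derivative \<phi> (at p) e = frechet_derivative \<phi> (at p) (fst e *\<^sub>R (1, 0) + snd e *\<^sub>R (0, 1))"
      by (rule arg_cong)
    then show "frechet_derivative \<phi> (at p) e = fst e * \<phi>x p + snd e * \<phi>v p"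
      unfolding linear_add[OF lin] linear_cmul[OF lin] by (simp add: \<phi>x_def \<phi>v_def)
  qed
  have D: "(\<phi> has_derivative (\<lambda>e. fst e * \<phi>x p + snd e * \<phi>v p)) (at p)" for p
    using F(1)[of p] unfolding eq .
  obtain a b where ab: "{p. \<phi> p \<noteq> 0} \<subseteq> box a b"
    using test_function_support_box[OF assms] by blast
  define M where "M = 1 + \<bar>fst a\<bar> + \<bar>fst b\<bar> + \<bar>snd a\<bar> + \<bar>snd b\<bar>"
  have z: "\<phi> p = 0" if "\<bar>fst p\<bar> \<ge> M \<or> \<bar>snd p\<bar> \<ge> M" for p
  proof (rule ccontr)
    assume "\<phi> p \<noteq> 0"
    then have "p \<in> box a b" using ab by auto
    then show False
      using that by (cases p; cases a; cases b) (auto simp: box_def Basis_prod_def M_def)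
  qed
  \<comment> \<open>The strict inequalities make \<open>S\<close> open, so that vanishing of
    \<open>\<phi>\<close> on \<open>S\<close> passes to its derivative. This is why
    \<open>\<phi>\<close> is known to vanish from \<open>M\<close> on but the partial derivatives
    only beyond \<open>M\<close>.\<close>
  define S where "S = {p::real\<times>real. \<bar>fst p\<bar> > M \<or> \<bar>snd p\<bar> > M}"
  have S: "open S"
    unfolding S_def by (intro open_Collect_disj open_Collect_less continuous_intros)
  have zD: "fst e * \<phi>x p + snd e * \<phi>v p = 0" if "p \<in> S" for p e
    by (rule has_derivative_zero_of_locally_zero[OF D S that]) (auto simp: S_def intro!: z)
  show thesis
  proof (rule that[OF _ D _ _ _ z])
    show "M > 0" by (simp add: M_def)
    show "continuous_on UNIV \<phi>" "continuous_on UNIV \<phi>x" "continuous_on UNIV \<phi>v"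
      using F(2,3) by (auto simp: \<phi>x_def \<phi>v_def)
    show "\<phi>x p = 0" if "\<bar>fst p\<bar> > M \<or> \<bar>snd p\<bar> > M" for p
      using zD[of p "(1,0)"] that by (simp add: S_def)
    show "\<phi>v p = 0" if "\<bar>fst p\<bar> > M \<or> \<bar>snd p\<bar> > M" for p
      using zD[of p "(0,1)"] that by (simp add: S_def)
    show "deriv (\<lambda>s. \<phi> (s, v)) x = \<phi>x (x, v)" for x v
    proof (rule DERIV_imp_deriv)
      have "((\<lambda>s. \<phi> (s, v)) has_derivative (\<lambda>e. fst (e, 0::real) * \<phi>x (x, v) + snd (e, 0::real) * \<phi>v (x, v))) (at x)"
        by (rule has_derivative_compose[OF _ D]) (auto intro!: derivative_eq_intros)
      then show "((\<lambda>s. \<phi> (s, v)) has_real_derivative \<phi>x (x, v)) (at x)"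
        by (simp add: has_field_derivative_def mult_commute_abs)
    qed
    show "deriv (\<lambda>w. \<phi> (x, w)) v = \<phi>v (x, v)" for x v
    proof (rule DERIV_imp_deriv)
      have "((\<lambda>w. \<phi> (x, w)) has_derivative (\<lambda>e. fst (0::real, e) * \<phi>x (x, v) + snd (0::real, e) * \<phi>v (x, v))) (at v)"
        by (rule has_derivative_compose[OF _ D]) (auto intro!: derivative_eq_intros)
      then show "((\<lambda>w. \<phi> (x, w)) has_real_derivative \<phi>v (x, v)) (at v)"
        by (simp add: has_field_derivative_def mult_commute_abs)
    qed
  qed
qed

section \<open>Weak derivatives: existence for C^1 functions, uniqueness\<close>

lemma weak_derivative_classical:
  assumes U: "\<And>x. (U has_real_derivative U' x) (at x)" and cU': "continuous_on UNIV U'"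
  shows "weak_derivative U U'"
  unfolding weak_derivative_def
proof (intro allI impI)
  fix \<phi> :: "real \<Rightarrow> real" assume "test_function \<phi>"
  then obtain a b where ab: "a < b" and D: "\<And>x. (\<phi> has_real_derivative deriv \<phi> x) (at x)"
    and cD: "continuous_on UNIV (deriv \<phi>)"
    and z: "\<And>x. x \<notin> {a<..<b} \<Longrightarrow> \<phi> x = 0" "\<And>x. x \<notin> {a..b} \<Longrightarrow> deriv \<phi> x = 0"
    by (rule test_function_1D) blast
  have cU: "continuous_on UNIV U" and c\<phi>: "continuous_on UNIV \<phi>"
    using U D by (meson DERIV_continuous_on has_field_derivative_at_within)+
  have i1: "integrable lebesgue (\<lambda>x. U x * deriv \<phi> x)" "(LINT x|lebesgue. U x * deriv \<phi> x) = integral (cbox a b) (\<lambda>x. U x * deriv \<phi> x)"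
    by (intro lebesgue_integral_continuous_box_support[where a = a and b = b] continuous_on_mult cU cD;
        use z in simp)+
  have i2: "integrable lebesgue (\<lambda>x. U' x * \<phi> x)" "(LINT x|lebesgue. U' x * \<phi> x) = integral (cbox a b) (\<lambda>x. U' x * \<phi> x)"
    by (intro lebesgue_integral_continuous_box_support[where a = a and b = b] continuous_on_mult cU' c\<phi>;
        use z(1) in force)+
  have "((\<lambda>x. U x * deriv \<phi> x + U' x * \<phi> x) has_integral (U b * \<phi> b - U a * \<phi> a)) {a..b}"
  proof (rule fundamental_theorem_of_calculus)
    show "((\<lambda>x. U x * \<phi> x) has_vector_derivative U x * deriv \<phi> x + U' x * \<phi> x) (at x within {a..b})" for x
      unfolding has_real_derivative_iff_has_vector_derivative[symmetric]
      by (rule has_field_derivative_at_within[OF DERIV_mult'[OF U D]])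
  qed (use ab in simp)
  then have "integral {a..b} (\<lambda>x. U x * deriv \<phi> x + U' x * \<phi> x) = 0"
    using z(1) by (auto dest!: integral_unique)
  moreover have "integral {a..b} (\<lambda>x. U x * deriv \<phi> x + U' x * \<phi> x)
      = integral {a..b} (\<lambda>x. U x * deriv \<phi> x) + integral {a..b} (\<lambda>x. U' x * \<phi> x)"
    by (rule integral_add)
      (auto intro!: integrable_continuous_real continuous_on_mult
        continuous_on_subset[OF cU] continuous_on_subset[OF cU'] continuous_on_subset[OF cD] continuous_on_subset[OF c\<phi>])
  ultimately show "(LINT x|lebesgue. U x * deriv \<phi> x) = - (LINT x|lebesgue. U' x * \<phi> x)"
    using i1 i2 by simp
qed

lemma Linf_loc_continuous:
  assumes "continuous_on UNIV u"
  shows "Linf_loc u"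
  unfolding Linf_loc_def
proof (intro conjI allI impI)
  show "u \<in> borel_measurable lebesgue"
    using assms by (simp add: borel_measurable_continuous_onI measurable_completion)
  fix C :: "real set" assume "compact C"
  then have "compact (u ` C)"
    using compact_continuous_image continuous_on_subset[OF assms] by blast
  then obtain B where "\<forall>x\<in>C. \<bar>u x\<bar> \<le> B"
    by (auto dest!: compact_imp_bounded simp: bounded_iff)
  then show "\<exists>B. AE x in lebesgue. x \<in> C \<longrightarrow> \<bar>u x\<bar> \<le> B" by auto
qed

lemma Linf_loc_diff:
  assumes "Linf_loc u" "Linf_loc w"
  shows "Linf_loc (\<lambda>x. u x - w x)"
  unfolding Linf_loc_def
proof (intro conjI allI impI)
  show "(\<lambda>x. u x - w x) \<in> borel_measurable lebesgue"
    using assms by (auto simp: Linf_loc_def intro: borel_measurable_diff)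
  fix C :: "real set" assume "compact C"
  then obtain A B where "AE x in lebesgue. x \<in> C \<longrightarrow> \<bar>u x\<bar> \<le> A" "AE x in lebesgue. x \<in> C \<longrightarrow> \<bar>w x\<bar> \<le> B"
    using assms unfolding Linf_loc_def by meson
  then have "AE x in lebesgue. x \<in> C \<longrightarrow> \<bar>u x - w x\<bar> \<le> A + B"
    by eventually_elim auto
  then show "\<exists>B. AE x in lebesgue. x \<in> C \<longrightarrow> \<bar>u x - w x\<bar> \<le> B" by blast
qed

lemma Linf_loc_absolutely_integrable:
  assumes "Linf_loc u"
  shows "u absolutely_integrable_on {a..b}"
proof -
  obtain B where "AE x in lebesgue. x \<in> {a..b} \<longrightarrow> \<bar>u x\<bar> \<le> B"
    using assms unfolding Linf_loc_def by (meson compact_Icc)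
  then show ?thesis
    unfolding set_integrable_def
    by (intro integrableI_bounded_set_indicator[where B = B])
      (use assms in \<open>auto simp: Linf_loc_def emeasure_lborel_Icc_eq\<close>)
qed

lemma Linf_loc_integrable_mult:
  assumes "Linf_loc u" "continuous_on UNIV \<phi>" "\<And>x. x \<notin> {a..b} \<Longrightarrow> \<phi> x = 0"
  shows "integrable lebesgue (\<lambda>x. u x * \<phi> x)"
proof -
  obtain B where B: "\<And>x. \<bar>\<phi> x\<bar> \<le> B"
    using compact_support_bound[of \<phi> a b] assms(2,3) by (metis cbox_interval)
  have "integrable lebesgue (\<lambda>x. (indicator {a..b} x *\<^sub>R u x) * B)"
    using Linf_loc_absolutely_integrable[OF assms(1), of a b] unfolding set_integrable_def
    by (rule integrable_mult_left)
  then show ?thesis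
  proof (rule Bochner_Integration.integrable_bound)
    show "(\<lambda>x. u x * \<phi> x) \<in> borel_measurable lebesgue"
      using assms(1,2) by (intro borel_measurable_times)
        (auto simp: Linf_loc_def borel_measurable_continuous_onI measurable_completion)
    have "\<bar>u x\<bar> * \<bar>\<phi> x\<bar> \<le> \<bar>indicator {a..b} x * u x\<bar> * \<bar>B\<bar>" for x
    proof (cases "x \<in> {a..b}")
      case True
      then show ?thesis using B[of x] by (auto intro!: mult_left_mono)
    qed (use assms(3) in auto)
    then show "AE x in lebesgue. norm (u x * \<phi> x) \<le> norm ((indicator {a..b} x *\<^sub>R u x) * B)"
      by (simp add: abs_mult)
  qed
qed

text \<open>The fundamental lemma of the calculus of variations. Bumps converging to an indicator
  show, by dominated convergence, that \<open>d\<close> has integral 0 over every interval; by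
  Lebesgue differentiation \<open>d\<close> is almost everywhere the limit of its averages over
  intervals \<open>[x, x + h]\<close>.\<close>

lemma Linf_loc_AE_zero:
  assumes d: "Linf_loc d"
    and 0: "\<And>\<phi>. test_function \<phi> \<Longrightarrow> (LINT x|lebesgue. d x * \<phi> x) = 0"
  shows "AE x in lebesgue. d x = 0"
proof -
  have ai: "d absolutely_integrable_on {a..b}" for a b
    by (rule Linf_loc_absolutely_integrable[OF d])
  have I: "integral {a..b} d = 0" if "a < b" for a b
  proof -
    have dm: "d \<in> borel_measurable lebesgue" using d by (simp add: Linf_loc_def)
    \<comment> \<open>\<open>Suc n\<close> instead of \<open>n\<close> keeps the scale positive, as
      \<open>test_function_bump\<close> requires.\<close>
    have "(\<lambda>n. LINT x|lebesgue. d x * bump (real (Suc n)) a b x)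
        \<longlonglongrightarrow> (LINT x|lebesgue. d x * indicator {a<..<b} x)"
    proof (rule integral_dominated_convergence[where w = "\<lambda>x. \<bar>indicator {a..b} x *\<^sub>R d x\<bar>"])
      show "(\<lambda>x. d x * indicator {a<..<b} x) \<in> borel_measurable lebesgue"
        by (rule borel_measurable_times[OF dm]) (simp add: borel_measurable_indicator)
      show "(\<lambda>x. d x * bump (real (Suc n)) a b x) \<in> borel_measurable lebesgue" for n
        using test_function_frechet(3)[OF test_function_bump[of "real (Suc n)" a b]]
        by (intro borel_measurable_times[OF dm])
          (simp add: borel_measurable_continuous_onI measurable_completion)
      show "integrable lebesgue (\<lambda>x. \<bar>indicator {a..b} x *\<^sub>R d x\<bar>)"
        using ai[of a b] unfolding set_integrable_def by (rule integrable_abs)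
      show "AE x in lebesgue. (\<lambda>n. d x * bump (real (Suc n)) a b x) \<longlonglongrightarrow> d x * indicator {a<..<b} x"
        using LIMSEQ_Suc[OF bump_tendsto[of a b]] by (auto intro!: tendsto_mult)
      have "\<bar>d x * bump (real (Suc n)) a b x\<bar> \<le> \<bar>indicator {a..b} x * d x\<bar>" for n x
      proof (cases "x \<in> {a..b}")
        case True
        then show ?thesis
          using bump_nonneg[of "real (Suc n)" a b x] bump_le_1[of "real (Suc n)" a b x]
          by (auto simp: abs_mult intro!: mult_left_le)
      next
        case False
        then show ?thesis using bump_eq_0[of "real (Suc n)" x a b] by auto
      qed
      then show "AE x in lebesgue. norm (d x * bump (real (Suc n)) a b x) \<le> \<bar>indicator {a..b} x *\<^sub>R d x\<bar>" for n
        by simp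
    qed
    moreover have "(LINT x|lebesgue. d x * bump (real (Suc n)) a b x) = 0" for n
      by (intro 0 test_function_bump) simp
    ultimately have *: "(LINT x|lebesgue. d x * indicator {a<..<b} x) = 0"
      by (simp add: LIMSEQ_const_iff)
    have "set_integrable lebesgue {a<..<b} d"
      by (rule set_integrable_subset[OF ai[of a b]]) auto
    then have "integral {a<..<b} d = 0"
      using set_lebesgue_integral_eq_integral(2)[of "{a<..<b}" d] *
      by (simp add: set_lebesgue_integral_def mult.commute)
    then show ?thesis by (simp add: integral_open_interval_real)
  qed
  obtain N where N: "negligible N" and lim: "\<And>x e. x \<notin> N \<Longrightarrow> 0 < e \<Longrightarrow>
      \<exists>r>0. \<forall>h. 0 < h \<and> h < r \<longrightarrow> norm (integral (cbox x (x + h *\<^sub>R One)) d /\<^sub>R h ^ DIM(real) - d x) < e"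
    by (rule integrable_ccontinuous_explicit[of d])
      (use ai in \<open>auto intro: set_lebesgue_integral_eq_integral(1)\<close>)
  have "d x = 0" if nx: "x \<notin> N" for x
  proof (rule ccontr)
    assume "d x \<noteq> 0"
    then obtain r where "r > 0" and r: "\<forall>h. 0 < h \<and> h < r \<longrightarrow>
        norm (integral (cbox x (x + h *\<^sub>R One)) d /\<^sub>R h ^ DIM(real) - d x) < \<bar>d x\<bar>"
      using lim[OF nx, of "\<bar>d x\<bar>"] by auto
    from r[rule_format, of "r / 2"] \<open>r > 0\<close> show False
      using I[of x "x + r / 2"] by simp
  qed
  then have "{x. d x \<noteq> 0} \<subseteq> N" by blast
  then have "{x. d x \<noteq> 0} \<in> null_sets lebesgue"
    using N negligible_subset negligible_iff_null_sets by blast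
  then show ?thesis by (rule AE_I'[where N = "{x. d x \<noteq> 0}"]) auto
qed

text \<open>Identifies the function \<open>g\<close> that a weak stationary state only asserts to
  exist with the classical derivative of the potential.\<close>

lemma weak_derivative_unique:
  assumes "weak_derivative U g" "weak_derivative U h" "Linf_loc g" "Linf_loc h"
  shows "AE x in lebesgue. g x = h x"
proof -
  have "AE x in lebesgue. g x - h x = 0"
  proof (rule Linf_loc_AE_zero[OF Linf_loc_diff[OF assms(3,4)]])
    fix \<phi> :: "real \<Rightarrow> real" assume \<phi>: "test_function \<phi>"
    then obtain a b where "\<And>x. x \<notin> {a<..<b} \<Longrightarrow> \<phi> x = 0"
      by (rule test_function_1D) blast
    then have z: "\<And>x. x \<notin> {a..b} \<Longrightarrow> \<phi> x = 0" by auto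
    note int = Linf_loc_integrable_mult[OF _ test_function_frechet(3)[OF \<phi>] z]
    have "(LINT x|lebesgue. (g x - h x) * \<phi> x) = (LINT x|lebesgue. g x * \<phi> x) - (LINT x|lebesgue. h x * \<phi> x)"
      using int[OF assms(3)] int[OF assms(4)] by (simp add: left_diff_distrib)
    also have "\<dots> = 0"
      using assms(1)[unfolded weak_derivative_def, rule_format, OF \<phi>]
        assms(2)[unfolded weak_derivative_def, rule_format, OF \<phi>] by simp
    finally show "(LINT x|lebesgue. (g x - h x) * \<phi> x) = 0" .
  qed
  then show ?thesis by simp
qed

section \<open>Null sets of the line as null strips of the plane\<close>

lemma AE_lborel_fst:
  assumes "AE x in lborel. P x"
  shows "AE p in (lborel :: (real \<times> real) measure). P (fst p)"
proof -
  obtain N where N: "N \<in> null_sets lborel" "{x. \<not> P x} \<subseteq> N"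
    using assms by (auto simp: eventually_ae_filter)
  have "N \<times> (UNIV :: real set) \<in> null_sets (lborel \<Otimes>\<^sub>M lborel)"
    using N(1) by (intro null_setsI) (auto simp: lborel.emeasure_pair_measure_Times null_sets_def)
  then show ?thesis
    unfolding lborel_prod by (rule AE_I') (use N(2) in auto)
qed

lemma AE_lborel_snd:
  assumes "AE x in lborel. P x"
  shows "AE p in (lborel :: (real \<times> real) measure). P (snd p)"
proof -
  obtain N where N: "N \<in> null_sets lborel" "{x. \<not> P x} \<subseteq> N"
    using assms by (auto simp: eventually_ae_filter)
  have "(UNIV :: real set) \<times> N \<in> null_sets (lborel \<Otimes>\<^sub>M lborel)"
    using N(1) by (intro null_setsI) (auto simp: lborel.emeasure_pair_measure_Times null_sets_def)
  then show ?thesis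
    unfolding lborel_prod by (rule AE_I') (use N(2) in auto)
qed

section \<open>C^1 regularity of the potential\<close>

lemma power_series_C1:
  assumes "real_analytic_power_series R \<Phi>"
  obtains \<Phi>' where "\<And>z. \<bar>z\<bar> < R \<Longrightarrow> (\<Phi> has_real_derivative \<Phi>' z) (at z)"
    "\<And>z. \<bar>z\<bar> < R \<Longrightarrow> isCont \<Phi>' z"
proof -
  obtain c where c: "\<And>z. \<bar>z\<bar> < R \<Longrightarrow> (\<lambda>n. c n * z ^ n) sums \<Phi> z"
    using assms by (auto simp: real_analytic_power_series_def)
  define \<Phi>' where "\<Phi>' = (\<lambda>z. \<Sum>n. diffs c n * z ^ n)"
  show thesis
  proof (rule that[of \<Phi>'])
    fix z :: real assume z: "\<bar>z\<bar> < R"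
    \<comment> \<open>Term-by-term differentiation at \<open>z\<close> asks for convergence at a
      point strictly farther from 0 than \<open>z\<close>.\<close>
    obtain r where r: "\<bar>z\<bar> < r" "r < R" using z dense by blast
    have s1: "summable (\<lambda>n. c n * r ^ n)"
      using c[of r] r by (auto simp: sums_iff)
    have s2: "summable (\<lambda>n. diffs c n * y ^ n)" if "\<bar>y\<bar> < R" for y
      by (rule termdiff_converges[of y R]) (use that c in \<open>auto simp: sums_iff\<close>)
    have "((\<lambda>z. \<Sum>n. c n * z ^ n) has_real_derivative \<Phi>' z) (at z)"
      unfolding \<Phi>'_def by (rule termdiffs_strong[OF s1]) (use r in auto)
    then show "(\<Phi> has_real_derivative \<Phi>' z) (at z)"
    proof (rule has_field_derivative_transform_within_open[where S = "{-R<..<R}"])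
      show "(\<Sum>n. c n * y ^ n) = \<Phi> y" if "y \<in> {-R<..<R}" for y
        using c[of y] that by (auto simp: sums_iff abs_less_iff)
    qed (use z in auto)
    show "isCont \<Phi>' z"
      unfolding \<Phi>'_def by (rule isCont_powser[OF s2[of r]]) (use r in auto)
  qed
qed

lemma potential_C1:
  assumes "real_analytic_power_series R \<Phi>" "rho f C1_differentiable_on UNIV"
    and "\<And>x. rho f x \<in> {-R<..<R}"
  obtains U' where "\<And>x. (potential \<Phi> f has_real_derivative U' x) (at x)" "continuous_on UNIV U'"
proof -
  obtain \<Phi>' where \<Phi>': "\<And>z. \<bar>z\<bar> < R \<Longrightarrow> (\<Phi> has_real_derivative \<Phi>' z) (at z)"
    "\<And>z. \<bar>z\<bar> < R \<Longrightarrow> isCont \<Phi>' z"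
    using power_series_C1[OF assms(1)] by blast
  obtain r' where r': "\<And>x. (rho f has_real_derivative r' x) (at x)" "continuous_on UNIV r'"
    using assms(2) by (auto simp: C1_differentiable_on_def has_real_derivative_iff_has_vector_derivative)
  have R: "\<bar>rho f x\<bar> < R" for x using assms(3)[of x] by auto
  have cr: "isCont (rho f) x" for x using r'(1) DERIV_isCont by blast
  show thesis
  proof (rule that[of "\<lambda>x. \<Phi>' (rho f x) * r' x"])
    show "(potential \<Phi> f has_real_derivative \<Phi>' (rho f x) * r' x) (at x)" for x
      using DERIV_chain[OF \<Phi>'(1)[OF R] r'(1)[of x]] by (simp add: potential_def[abs_def] o_def)
    show "continuous_on UNIV (\<lambda>x. \<Phi>' (rho f x) * r' x)"
      using r'(2) by (intro continuous_on_mult)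
        (auto intro!: continuous_at_imp_continuous_on isCont_o2[OF cr] \<Phi>'(2) R)
  qed
qed

section \<open>The transport equation\<close>

text \<open>The integrand is the divergence form of the equation, the x-derivative of v q phi minus
  the v-derivative of U' q phi. The vertical edges contribute nothing because \<open>\<phi>\<close>
  vanishes there, so only the horizontal edges \<open>c\<close> and \<open>d\<close> remain. Nothing
  is asked of \<open>\<phi>\<close> on these, so that one of them may be the line v = 0.\<close>

lemma box_green:
  fixes q qx qv \<phi> \<phi>x \<phi>v :: "real \<times> real \<Rightarrow> real" and U' :: "real \<Rightarrow> real"
  assumes ab: "a \<le> b" and cd: "c \<le> d" and cU': "continuous_on UNIV U'"
    and cq: "continuous_on (cbox (a, c) (b, d)) q" "continuous_on (cbox (a, c) (b, d)) qx"
      "continuous_on (cbox (a, c) (b, d)) qv"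
    and c\<phi>: "continuous_on UNIV \<phi>" "continuous_on UNIV \<phi>x" "continuous_on UNIV \<phi>v"
    and dq: "\<And>x v. x \<in> {a..b} \<Longrightarrow> v \<in> {c..d} \<Longrightarrow> (q has_derivative (\<lambda>e. fst e * qx (x, v) + snd e * qv (x, v))) (at (x, v))"
    and d\<phi>: "\<And>p. (\<phi> has_derivative (\<lambda>e. fst e * \<phi>x p + snd e * \<phi>v p)) (at p)"
    and z: "\<And>v. v \<in> {c..d} \<Longrightarrow> \<phi> (a, v) = 0" "\<And>v. v \<in> {c..d} \<Longrightarrow> \<phi> (b, v) = 0"
  shows "integral (cbox (a, c) (b, d)) (\<lambda>p. q p * (snd p * \<phi>x p - U' (fst p) * \<phi>v p)
      + \<phi> p * (snd p * qx p - U' (fst p) * qv p))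
    = integral {a..b} (\<lambda>x. U' x * (q (x, c) * \<phi> (x, c) - q (x, d) * \<phi> (x, d)))"
proof -
  let ?B = "cbox (a, c) (b, d)"
  have cU: "continuous_on S (\<lambda>p. U' (fst p))" for S :: "(real \<times> real) set"
    by (rule continuous_on_compose2[OF cU']) (auto intro!: continuous_intros)
  note cs = cq c\<phi>[THEN continuous_on_subset, OF subset_UNIV] cU
  define A where "A = (\<lambda>p. snd p * (q p * \<phi>x p + qx p * \<phi> p))"
  define B where "B = (\<lambda>p. U' (fst p) * (q p * \<phi>v p + qv p * \<phi> p))"
  have cA: "continuous_on ?B A" unfolding A_def by (intro continuous_intros cs)
  have cB: "continuous_on ?B B" unfolding B_def by (intro continuous_intros cs)
  have dx: "((\<lambda>s. q (s, v) * \<phi> (s, v)) has_real_derivative q (x, v) * \<phi>x (x, v) + qx (x, v) * \<phi> (x, v)) (at x)"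
    if "x \<in> {a..b}" "v \<in> {c..d}" for x v
  proof (rule DERIV_mult')
    have l: "((\<lambda>s. (s, v)) has_derivative (\<lambda>e. (e, 0))) (at x)"
      by (auto intro!: derivative_eq_intros)
    show "((\<lambda>s. q (s, v)) has_real_derivative qx (x, v)) (at x)"
      using has_derivative_compose[OF l dq[OF that]]
      by (simp add: has_field_derivative_def mult_commute_abs)
    show "((\<lambda>s. \<phi> (s, v)) has_real_derivative \<phi>x (x, v)) (at x)"
      using has_derivative_compose[OF l d\<phi>]
      by (simp add: has_field_derivative_def mult_commute_abs)
  qed
  have dv: "((\<lambda>s. q (x, s) * \<phi> (x, s)) has_real_derivative q (x, v) * \<phi>v (x, v) + qv (x, v) * \<phi> (x, v)) (at v)"
    if "x \<in> {a..b}" "v \<in> {c..d}" for x v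
  proof (rule DERIV_mult')
    have l: "((\<lambda>s. (x, s)) has_derivative (\<lambda>e. (0, e))) (at v)"
      by (auto intro!: derivative_eq_intros)
    show "((\<lambda>s. q (x, s)) has_real_derivative qv (x, v)) (at v)"
      using has_derivative_compose[OF l dq[OF that]]
      by (simp add: has_field_derivative_def mult_commute_abs)
    show "((\<lambda>s. \<phi> (x, s)) has_real_derivative \<phi>v (x, v)) (at v)"
      using has_derivative_compose[OF l d\<phi>]
      by (simp add: has_field_derivative_def mult_commute_abs)
  qed
  have "integral ?B A = integral {a..b} (\<lambda>x. integral {c..d} (\<lambda>v. A (x, v)))"
    using integral_prod_continuous[OF cA] by simp
  \<comment> \<open>\<open>A\<close> is \<open>v\<close> times an x-derivative, so the x-integral
    has to be the inner one; \<open>B\<close> below is integrated in v first.\<close>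
  also have "\<dots> = integral {c..d} (\<lambda>v. integral {a..b} (\<lambda>x. A (x, v)))"
    using integral_swap_continuous[of a c b d "\<lambda>x v. A (x, v)"] cA by simp
  also have "\<dots> = integral {c..d} (\<lambda>v. 0)"
  proof (rule integral_cong)
    fix v assume v: "v \<in> {c..d}"
    have "((\<lambda>x. q (x, v) * \<phi>x (x, v) + qx (x, v) * \<phi> (x, v)) has_integral
        q (b, v) * \<phi> (b, v) - q (a, v) * \<phi> (a, v)) {a..b}"
      by (rule fundamental_theorem_of_calculus[OF ab], fold has_real_derivative_iff_has_vector_derivative,
          rule has_field_derivative_at_within[OF dx]) (use v in auto)
    from has_integral_mult_right[OF this, of v]
    have "((\<lambda>x. A (x, v)) has_integral 0) {a..b}"
      using z[OF v] by (simp add: A_def)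
    then show "integral {a..b} (\<lambda>x. A (x, v)) = 0"
      by (rule integral_unique)
  qed
  finally have IA: "integral ?B A = 0" by simp
  have "integral ?B B = integral {a..b} (\<lambda>x. integral {c..d} (\<lambda>v. B (x, v)))"
    using integral_prod_continuous[OF cB] by simp
  also have "\<dots> = integral {a..b} (\<lambda>x. - (U' x * (q (x, c) * \<phi> (x, c) - q (x, d) * \<phi> (x, d))))"
  proof (rule integral_cong)
    fix x assume x: "x \<in> {a..b}"
    have "((\<lambda>v. q (x, v) * \<phi>v (x, v) + qv (x, v) * \<phi> (x, v)) has_integral
        q (x, d) * \<phi> (x, d) - q (x, c) * \<phi> (x, c)) {c..d}"
      by (rule fundamental_theorem_of_calculus[OF cd], fold has_real_derivative_iff_has_vector_derivative,
          rule has_field_derivative_at_within[OF dv]) (use x in auto)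
    from has_integral_mult_right[OF this, of "U' x"]
    have "((\<lambda>v. B (x, v)) has_integral - (U' x * (q (x, c) * \<phi> (x, c) - q (x, d) * \<phi> (x, d)))) {c..d}"
      by (simp add: B_def right_diff_distrib)
    then show "integral {c..d} (\<lambda>v. B (x, v)) = - (U' x * (q (x, c) * \<phi> (x, c) - q (x, d) * \<phi> (x, d)))"
      by (rule integral_unique)
  qed
  finally have IB: "integral ?B B = - integral {a..b} (\<lambda>x. U' x * (q (x, c) * \<phi> (x, c) - q (x, d) * \<phi> (x, d)))"
    by simp
  have "(\<lambda>p. q p * (snd p * \<phi>x p - U' (fst p) * \<phi>v p) + \<phi> p * (snd p * qx p - U' (fst p) * qv p))
      = (\<lambda>p. A p - B p)"
    by (auto simp: A_def B_def algebra_simps)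
  then show ?thesis
    using IA IB integral_diff[OF integrable_continuous[OF cA] integrable_continuous[OF cB]] by simp
qed

lemma AE_lebesgue_fst:
  assumes "AE x in lebesgue. P x"
  shows "AE p in (lebesgue :: (real \<times> real) measure). P (fst p)"
  using AE_completion[OF AE_lborel_fst[of P]] assms by (simp add: AE_completion_iff)

lemma AE_lebesgue_snd_nonzero: "AE p in (lebesgue :: (real \<times> real) measure). snd p \<noteq> 0"
  by (rule AE_completion[OF AE_lborel_snd]) (rule AE_lborel_singleton)

text \<open>\<open>U\<close> stands for the potential. The link to \<open>\<Phi>\<close> and
  \<open>rho\<close> is made by the assumption of \<open>weak_stationary_state_iff\<close> and by
  the interpretation in the theorem.\<close>

locale phase_space =
  fixes f :: "real \<Rightarrow> real \<Rightarrow> real" and U U' :: "real \<Rightarrow> real"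
  assumes U_deriv: "\<And>x. (U has_real_derivative U' x) (at x)"
    and U'_cont: "continuous_on UNIV U'"
    and f_C1: "Ck_on 1 ({(x, v). v < 0} \<union> {(x, v). v > 0}) (\<lambda>(x, v). f x v)"
    and f_L1_loc: "L1_loc (\<lambda>(x, v). f x v)"
    and f_slice: "\<And>x. integrable lebesgue (f x)"
begin

definition fx :: "real \<times> real \<Rightarrow> real" where
  "fx p = frechet_derivative (\<lambda>(x, v). f x v) (at p) (1, 0)"

definition fv :: "real \<times> real \<Rightarrow> real" where
  "fv p = frechet_derivative (\<lambda>(x, v). f x v) (at p) (0, 1)"

text \<open>Nothing is assumed about \<open>f\<close> on the null set \<open>v = 0\<close>; resetting it there makes it Borel.\<close>

definition f0 :: "real \<times> real \<Rightarrow> real" where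
  "f0 p = (if snd p = 0 then 0 else f (fst p) (snd p))"

lemma domain_eq: "{(x, v). v < 0} \<union> {(x, v). v > 0} = {p :: real \<times> real. snd p \<noteq> 0}"
  by auto

lemma open_domain: "open {p :: real \<times> real. snd p \<noteq> 0}"
  by (intro open_Collect_neq continuous_intros)

lemma U_cont: "continuous_on S U"
  by (meson DERIV_continuous_on U_deriv has_field_derivative_at_within)

lemma f_has_derivative:
  assumes "snd p \<noteq> 0"
  shows "((\<lambda>(x, v). f x v) has_derivative (\<lambda>e. fst e * fx p + snd e * fv p)) (at p)"
proof -
  let ?D = "frechet_derivative (\<lambda>(x, v). f x v) (at p)"
  have D: "((\<lambda>(x, v). f x v) has_derivative ?D) (at p)"
    using f_C1 assms unfolding domain_eq by (cases p) (auto simp: frechet_derivative_works)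
  note lin = has_derivative_linear[OF D]
  have "?D e = fst e * fx p + snd e * fv p" for e
  proof -
    have "?D e = ?D (fst e *\<^sub>R (1, 0) + snd e *\<^sub>R (0, 1))"
      by (rule arg_cong) (simp add: prod_eq_iff)
    then show ?thesis
      unfolding linear_add[OF lin] linear_cmul[OF lin] by (simp add: fx_def fv_def)
  qed
  then have "?D = (\<lambda>e. fst e * fx p + snd e * fv p)" by blast
  with D show ?thesis by simp
qed

lemma fx_cont: "continuous_on {p. snd p \<noteq> 0} fx"
  and fv_cont: "continuous_on {p. snd p \<noteq> 0} fv"
  using f_C1 unfolding domain_eq fx_def[abs_def] fv_def[abs_def] by auto

lemma f_cont: "continuous_on {p. snd p \<noteq> 0} (\<lambda>(x, v). f x v)"
  by (intro continuous_at_imp_continuous_on ballI has_derivative_continuous[OF f_has_derivative]) simp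

text \<open>Taken with the speed \<open>w\<close> at a fixed energy, for which
  \<open>w' = - U' x / w x\<close>, the right-hand side is the transport operator applied to
  \<open>f\<close> and divided by the speed.\<close>

lemma f_has_real_derivative_along:
  assumes "(w has_real_derivative w') (at x)" "w x \<noteq> 0"
  shows "((\<lambda>x. f x (w x)) has_real_derivative fx (x, w x) + w' * fv (x, w x)) (at x)"
proof -
  have "((\<lambda>x. (x, w x)) has_derivative (\<lambda>e. (e, e * w'))) (at x)"
    using assms(1) by (auto intro!: derivative_eq_intros simp: has_field_derivative_def mult_commute_abs)
  from has_derivative_compose[OF this f_has_derivative, of] assms(2)
  have "((\<lambda>x. f x (w x)) has_derivative (\<lambda>e. e * fx (x, w x) + e * w' * fv (x, w x))) (at x)"
    by simp
  then show ?thesis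
    unfolding has_field_derivative_def by (rule has_derivative_eq_rhs) (auto simp: algebra_simps)
qed

lemma f0_measurable: "f0 \<in> borel_measurable borel"
proof -
  have "(\<lambda>p. indicator {p. snd p \<noteq> 0} p *\<^sub>R (case p of (x, v) \<Rightarrow> f x v)) \<in> borel_measurable borel"
    by (rule borel_measurable_continuous_on_indicator[OF borel_open[OF open_domain] f_cont])
  also have "(\<lambda>p. indicator {p. snd p \<noteq> 0} p *\<^sub>R (case p of (x, v) \<Rightarrow> f x v)) = f0"
    by (auto simp: f0_def indicator_def)
  finally show ?thesis .
qed

lemma continuous_transport:
  assumes "continuous_on UNIV \<phi>x" "continuous_on UNIV \<phi>v"
  shows "continuous_on UNIV (\<lambda>p. snd p * \<phi>x p - U' (fst p) * \<phi>v p)"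
  by (intro continuous_intros assms continuous_on_compose2[OF U'_cont]) auto

lemma weak_integrand_measurable:
  assumes "continuous_on UNIV \<phi>x" "continuous_on UNIV \<phi>v"
  shows "(\<lambda>p. f0 p * (snd p * \<phi>x p - U' (fst p) * \<phi>v p)) \<in> borel_measurable borel"
  by (intro borel_measurable_times f0_measurable borel_measurable_continuous_onI continuous_transport assms)

lemma weak_integral_eq:
  assumes g: "AE x in lebesgue. g x = U' x" and \<phi>: "test_function \<phi>"
    and c: "continuous_on UNIV \<phi>x" "continuous_on UNIV \<phi>v"
    and dx: "\<And>x v. deriv (\<lambda>s. \<phi> (s, v)) x = \<phi>x (x, v)"
    and dv: "\<And>x v. deriv (\<lambda>w. \<phi> (x, w)) v = \<phi>v (x, v)"
  shows "(LINT (x, v)|lebesgue. f x v * (v * deriv (\<lambda>s. \<phi> (s, v)) x - g x * deriv (\<lambda>w. \<phi> (x, w)) v))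
    = (LINT p|lborel. f0 p * (snd p * \<phi>x p - U' (fst p) * \<phi>v p))"
    (is "?L = (LINT p|lborel. ?F p)")
proof -
  have F: "?F \<in> borel_measurable lborel"
    using weak_integrand_measurable[OF c] by simp
  have AE: "AE p in lebesgue. ?F p = (case p of (x, v) \<Rightarrow>
      f x v * (v * deriv (\<lambda>s. \<phi> (s, v)) x - g x * deriv (\<lambda>w. \<phi> (x, w)) v))"
    using AE_lebesgue_fst[OF g] AE_lebesgue_snd_nonzero
    by eventually_elim (auto simp: f0_def dx dv)
  \<comment> \<open>The original integrand inherits its measurability from \<open>?F\<close>, since
    \<open>lebesgue\<close> is complete.\<close>
  have "?L = (LINT p|lebesgue. ?F p)"
    by (rule integral_cong_AE[OF borel_measurable_AE[OF _ AE]])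
      (use F AE in \<open>auto intro: measurable_completion\<close>)
  also have "\<dots> = (LINT p|lborel. ?F p)"
    by (rule integral_completion[OF F])
  finally show ?thesis .
qed

lemma weak_integrable:
  assumes c: "continuous_on UNIV \<phi>x" "continuous_on UNIV \<phi>v"
    and z: "\<And>p. \<bar>fst p\<bar> > M \<or> \<bar>snd p\<bar> > M \<Longrightarrow> \<phi>x p = 0" "\<And>p. \<bar>fst p\<bar> > M \<or> \<bar>snd p\<bar> > M \<Longrightarrow> \<phi>v p = 0"
  shows "integrable lborel (\<lambda>p. f0 p * (snd p * \<phi>x p - U' (fst p) * \<phi>v p))"
proof -
  let ?h = "\<lambda>p. snd p * \<phi>x p - U' (fst p) * \<phi>v p"
  let ?C = "cbox (-M, -M) (M, M) :: (real \<times> real) set"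
  have ch: "continuous_on UNIV ?h"
    by (rule continuous_transport[OF c])
  have zh: "?h p = 0" if "p \<notin> ?C" for p
  proof -
    have "\<bar>fst p\<bar> > M \<or> \<bar>snd p\<bar> > M"
      using that by (cases p) (auto simp: cbox_Pair_eq)
    then show ?thesis using z by simp
  qed
  obtain B where B: "\<And>p. \<bar>?h p\<bar> \<le> B"
    using compact_support_bound[OF ch zh] by blast
  have "integrable lebesgue (\<lambda>p. (indicator ?C p *\<^sub>R (case p of (x, v) \<Rightarrow> f x v)) * B)"
    using f_L1_loc unfolding L1_loc_def set_integrable_def
    by (intro integrable_mult_left) (use compact_cbox in blast)
  then have "integrable lebesgue (\<lambda>p. f0 p * ?h p)"
  proof (rule Bochner_Integration.integrable_bound)
    show "(\<lambda>p. f0 p * ?h p) \<in> borel_measurable lebesgue"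
      using weak_integrand_measurable[OF c] by (simp add: measurable_completion)
    have "\<bar>f0 p * ?h p\<bar> \<le> \<bar>indicator ?C p * (case p of (x, v) \<Rightarrow> f x v) * B\<bar>" for p
    proof (cases "p \<in> ?C \<and> snd p \<noteq> 0")
      case True
      then show ?thesis using B[of p]
        by (auto simp: f0_def abs_mult split_beta intro!: mult_left_mono)
    next
      case False
      then show ?thesis using zh[of p] by (auto simp: f0_def)
    qed
    then show "AE p in lebesgue. norm (f0 p * ?h p)
        \<le> norm ((indicator ?C p *\<^sub>R (case p of (x, v) \<Rightarrow> f x v)) * B)"
      by simp
  qed
  then show ?thesis
    using weak_integrand_measurable[OF c] by (subst (asm) integrable_completion) auto
qed

text \<open>The equation for Borel data: \<open>g\<close> is replaced by \<open>U'\<close> and \<open>deriv\<close> by continuous partial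
  derivatives \<open>\<phi>x\<close>, \<open>\<phi>v\<close> (which \<open>\<phi>\<close> determines).\<close>

definition weak_solution :: bool where
  "weak_solution \<longleftrightarrow> (\<forall>\<phi> \<phi>x \<phi>v M. test_function \<phi> \<longrightarrow> M > 0 \<longrightarrow>
     (\<forall>p. (\<phi> has_derivative (\<lambda>e. fst e * \<phi>x p + snd e * \<phi>v p)) (at p)) \<longrightarrow>
     continuous_on UNIV \<phi>x \<longrightarrow> continuous_on UNIV \<phi>v \<longrightarrow>
     (\<forall>p. \<bar>fst p\<bar> \<ge> M \<or> \<bar>snd p\<bar> \<ge> M \<longrightarrow> \<phi> p = 0) \<longrightarrow>
     (\<forall>p. \<bar>fst p\<bar> > M \<or> \<bar>snd p\<bar> > M \<longrightarrow> \<phi>x p = 0 \<and> \<phi>v p = 0) \<longrightarrow>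
     (LINT p|lborel. f0 p * (snd p * \<phi>x p - U' (fst p) * \<phi>v p)) = 0)"

section \<open>Equivalence of weak stationarity with the equation for Borel data\<close>

lemma weak_stationary_state_iff:
  assumes "potential \<Phi> f = U"
  shows "weak_stationary_state \<Phi> f \<longleftrightarrow> weak_solution"
proof
  assume "weak_stationary_state \<Phi> f"
  then obtain g where g: "Linf_loc g" "weak_derivative U g"
    and eq: "\<And>\<phi> :: real \<times> real \<Rightarrow> real. test_function \<phi> \<Longrightarrow>
      (LINT (x, v)|lebesgue. f x v * (v * deriv (\<lambda>s. \<phi> (s, v)) x - g x * deriv (\<lambda>w. \<phi> (x, w)) v)) = 0"
    unfolding weak_stationary_state_def assms by blast
  have AE: "AE x in lebesgue. g x = U' x"
    by (rule weak_derivative_unique[OF g(2) weak_derivative_classical[OF U_deriv U'_cont] g(1)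
          Linf_loc_continuous[OF U'_cont]])
  show weak_solution
    unfolding weak_solution_def
  proof (intro allI impI)
    fix \<phi> \<phi>x \<phi>v :: "real \<times> real \<Rightarrow> real"
    assume \<phi>: "test_function \<phi>" and D: "\<forall>p. (\<phi> has_derivative (\<lambda>e. fst e * \<phi>x p + snd e * \<phi>v p)) (at p)"
      and c: "continuous_on UNIV \<phi>x" "continuous_on UNIV \<phi>v"
    obtain \<psi>x \<psi>v where D': "\<And>p. (\<phi> has_derivative (\<lambda>e. fst e * \<psi>x p + snd e * \<psi>v p)) (at p)"
      and d: "\<And>x v. deriv (\<lambda>s. \<phi> (s, v)) x = \<psi>x (x, v)" "\<And>x v. deriv (\<lambda>w. \<phi> (x, w)) v = \<psi>v (x, v)"
      by (rule test_function_2D[OF \<phi>]) blast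
    \<comment> \<open>The given partial derivatives need not syntactically be those supplied by
      \<open>test_function_2D\<close>, but both pairs represent the same Frechet derivative;
      evaluating it at the two unit vectors identifies them.\<close>
    have e: "(\<lambda>e. fst e * \<psi>x p + snd e * \<psi>v p) = (\<lambda>e. fst e * \<phi>x p + snd e * \<phi>v p)" for p
      using has_derivative_unique D D' by blast
    have "\<psi>x p = \<phi>x p" "\<psi>v p = \<phi>v p" for p
      using fun_cong[OF e[of p], of "(1, 0)"] fun_cong[OF e[of p], of "(0, 1)"] by simp_all
    then have "\<psi>x = \<phi>x" "\<psi>v = \<phi>v" by auto
    then show "(LINT p|lborel. f0 p * (snd p * \<phi>x p - U' (fst p) * \<phi>v p)) = 0"
      using weak_integral_eq[OF AE \<phi> c] d eq[OF \<phi>] by simp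
  qed
next
  assume w: weak_solution
  show "weak_stationary_state \<Phi> f"
    unfolding weak_stationary_state_def assms
  proof (intro conjI exI[of _ U'] allI impI)
    show "Linf_loc U" "Linf_loc U'" "weak_derivative U U'"
      using Linf_loc_continuous U_cont U'_cont weak_derivative_classical[OF U_deriv U'_cont] by auto
    show "L1_loc (\<lambda>(x, v). f x v)" "AE x in lebesgue. integrable lebesgue (f x)"
      using f_L1_loc f_slice by auto
    fix \<phi> :: "real \<times> real \<Rightarrow> real" assume \<phi>: "test_function \<phi>"
    obtain \<phi>x \<phi>v M where M: "0 < M"
      "\<And>p. (\<phi> has_derivative (\<lambda>e. fst e * \<phi>x p + snd e * \<phi>v p)) (at p)"
      and c: "continuous_on UNIV \<phi>x" "continuous_on UNIV \<phi>v"
      and z: "\<And>p. \<bar>fst p\<bar> \<ge> M \<or> \<bar>snd p\<bar> \<ge> M \<Longrightarrow> \<phi> p = 0"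
      "\<And>p. \<bar>fst p\<bar> > M \<or> \<bar>snd p\<bar> > M \<Longrightarrow> \<phi>x p = 0" "\<And>p. \<bar>fst p\<bar> > M \<or> \<bar>snd p\<bar> > M \<Longrightarrow> \<phi>v p = 0"
      and d: "\<And>x v. deriv (\<lambda>s. \<phi> (s, v)) x = \<phi>x (x, v)" "\<And>x v. deriv (\<lambda>w. \<phi> (x, w)) v = \<phi>v (x, v)"
      by (rule test_function_2D[OF \<phi>]) blast
    have "(LINT p|lborel. f0 p * (snd p * \<phi>x p - U' (fst p) * \<phi>v p)) = 0"
      using w[unfolded weak_solution_def, rule_format, OF \<phi> M c z(1)] z(2,3) by blast
    then show "(LINT (x, v)|lebesgue. f x v * (v * deriv (\<lambda>s. \<phi> (s, v)) x - U' x * deriv (\<lambda>w. \<phi> (x, w)) v)) = 0"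
      using weak_integral_eq[OF _ \<phi> c d, of U'] by simp
  qed
qed


text \<open>Localizes the weak equation to a box in the form that \<open>box_green\<close> can be
  compared with. The box may cross v = 0, which is what the jump argument needs.\<close>

lemma weak_solution_bump:
  assumes w: weak_solution and ab: "a < b" and cd: "c < d"
  obtains \<phi> \<phi>x \<phi>v where "\<And>p. (\<phi> has_derivative (\<lambda>e. fst e * \<phi>x p + snd e * \<phi>v p)) (at p)"
    "continuous_on UNIV \<phi>" "continuous_on UNIV \<phi>x" "continuous_on UNIV \<phi>v"
    "\<And>p. \<phi> p = bump 1 a b (fst p) * bump 1 c d (snd p)"
    "((\<lambda>p. f0 p * (snd p * \<phi>x p - U' (fst p) * \<phi>v p)) has_integral 0) (cbox (a, c) (b, d))"
proof -
  define \<phi> :: "real \<times> real \<Rightarrow> real" where "\<phi> = (\<lambda>p. bump 1 a b (fst p) * bump 1 c d (snd p))"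
  have \<phi>: "test_function \<phi>"
    unfolding \<phi>_def by (rule test_function_bump_prod) simp
  obtain \<phi>x \<phi>v M where M: "0 < M"
    and D: "\<And>p. (\<phi> has_derivative (\<lambda>e. fst e * \<phi>x p + snd e * \<phi>v p)) (at p)"
    and c\<phi>: "continuous_on UNIV \<phi>"
    and c: "continuous_on UNIV \<phi>x" "continuous_on UNIV \<phi>v"
    and z: "\<And>p. \<bar>fst p\<bar> \<ge> M \<or> \<bar>snd p\<bar> \<ge> M \<Longrightarrow> \<phi> p = 0"
      "\<And>p. \<bar>fst p\<bar> > M \<or> \<bar>snd p\<bar> > M \<Longrightarrow> \<phi>x p = 0" "\<And>p. \<bar>fst p\<bar> > M \<or> \<bar>snd p\<bar> > M \<Longrightarrow> \<phi>v p = 0"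
    by (rule test_function_2D[OF \<phi>]) blast
  let ?F = "\<lambda>p. f0 p * (snd p * \<phi>x p - U' (fst p) * \<phi>v p)"
  let ?B = "cbox (a, c) (b, d)"
  have 0: "(LINT p|lborel. ?F p) = 0"
    using w[unfolded weak_solution_def, rule_format, OF \<phi> M D c z(1)] z(2,3) by blast
  have int: "integrable lebesgue ?F"
    using weak_integrable[OF c z(2,3)] weak_integrand_measurable[OF c] by (subst integrable_completion) auto
  have zD: "fst e * \<phi>x p + snd e * \<phi>v p = 0" if "p \<notin> ?B" for p e
  proof (rule has_derivative_zero_of_locally_zero[OF D, of "- ?B"])
    fix p assume "p \<in> - ?B"
    then have "fst p < a \<or> b < fst p \<or> snd p < c \<or> d < snd p"
      by (cases p) (auto simp: cbox_Pair_eq)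
    then show "\<phi> p = 0"
      using bump_eq_0[of 1 "fst p" a b] bump_eq_0[of 1 "snd p" c d] by (auto simp: \<phi>_def)
  qed (use that in \<open>auto simp: open_Compl\<close>)
  have zF: "?F p = 0" if "p \<notin> ?B" for p
    using zD[OF that, of "(1, 0)"] zD[OF that, of "(0, 1)"] by simp
  have ai: "?F absolutely_integrable_on ?B"
    using integrable_mult_indicator[OF _ int, of ?B] unfolding set_integrable_def by simp
  have "integral ?B ?F = (LINT p|lebesgue. ?F p)"
    by (rule lebesgue_integral_box_support(2)[OF ai zF, symmetric])
  also have "\<dots> = 0"
    using 0 weak_integrand_measurable[OF c] by (subst integral_completion) auto
  finally have "(?F has_integral 0) ?B"
    using set_lebesgue_integral_eq_integral(1)[OF ai] by (metis has_integral_integral)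
  with D c\<phi> c show thesis
    by (intro that[of \<phi> \<phi>x \<phi>v]) (auto simp: \<phi>_def)
qed

text \<open>If the equation failed at \<open>p0\<close>, its defect \<open>P\<close> would keep one
  sign on a small box around \<open>p0\<close>. A bump vanishing on the boundary of that box removes
  all boundary terms in Green's formula, so the integral of \<open>\<phi>\<close> times
  \<open>P\<close> is 0, which contradicts the sign.\<close>

lemma weak_solution_transport:
  assumes w: weak_solution and p0: "snd p0 \<noteq> 0"
  shows "snd p0 * fx p0 = U' (fst p0) * fv p0"
proof (rule ccontr)
  define P where "P = (\<lambda>p. snd p * fx p - U' (fst p) * fv p)"
  assume "snd p0 * fx p0 \<noteq> U' (fst p0) * fv p0"
  then have P0: "P p0 \<noteq> 0" by (simp add: P_def)
  have cP: "continuous_on {p. snd p \<noteq> 0} P"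
    unfolding P_def by (intro continuous_intros fx_cont fv_cont continuous_on_compose2[OF U'_cont]) auto
  \<comment> \<open>Multiplying by the value at \<open>p0\<close> treats both signs of the defect at
    once.\<close>
  define S where "S = {p. snd p \<noteq> 0} \<inter> (\<lambda>p. P p * P p0) -` {0<..}"
  have "open S"
    unfolding S_def
    by (rule continuous_open_preimage[OF _ open_domain]) (auto intro!: continuous_intros cP)
  moreover have "p0 \<in> S" using p0 P0 by (auto simp: S_def zero_less_mult_iff)
  ultimately obtain l u where lu: "cbox l u \<subseteq> S" "p0 \<in> box l u"
    using open_contains_cbox by metis
  obtain a c where l: "l = (a, c)" by (cases l)
  obtain b d where u: "u = (b, d)" by (cases u)
  have p0box: "a < fst p0" "fst p0 < b" "c < snd p0" "snd p0 < d"
    using lu(2) by (cases p0; auto simp: l u box_def Basis_prod_def)+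
  then have ab: "a < b" and cd: "c < d" by auto
  let ?B = "cbox (a, c) (b, d)"
  obtain \<phi> \<phi>x \<phi>v where D: "\<And>p. (\<phi> has_derivative (\<lambda>e. fst e * \<phi>x p + snd e * \<phi>v p)) (at p)"
    and c\<phi>: "continuous_on UNIV \<phi>" "continuous_on UNIV \<phi>x" "continuous_on UNIV \<phi>v"
    and \<phi>: "\<And>p. \<phi> p = bump 1 a b (fst p) * bump 1 c d (snd p)"
    and I: "((\<lambda>p. f0 p * (snd p * \<phi>x p - U' (fst p) * \<phi>v p)) has_integral 0) ?B"
    by (rule weak_solution_bump[OF w ab cd]) blast
  have sub: "?B \<subseteq> {p. snd p \<noteq> 0}" using lu(1) by (auto simp: l u S_def)
  let ?q = "\<lambda>(x, v). f x v"
  let ?G = "\<lambda>p. ?q p * (snd p * \<phi>x p - U' (fst p) * \<phi>v p)"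
  have IG: "(?G has_integral 0) ?B"
    by (rule has_integral_eq[OF _ I]) (use sub in \<open>auto simp: f0_def\<close>)
  have c\<phi>P: "continuous_on ?B (\<lambda>p. \<phi> p * P p)"
    by (intro continuous_intros continuous_on_subset[OF c\<phi>(1)] continuous_on_subset[OF cP] sub) auto
  have "integral ?B (\<lambda>p. ?G p + \<phi> p * (snd p * fx p - U' (fst p) * fv p))
      = integral {a..b} (\<lambda>x. U' x * (?q (x, c) * \<phi> (x, c) - ?q (x, d) * \<phi> (x, d)))"
  proof (rule box_green[OF less_imp_le[OF ab] less_imp_le[OF cd] U'_cont])
    show "continuous_on ?B ?q" "continuous_on ?B fx" "continuous_on ?B fv"
      using f_cont fx_cont fv_cont sub by (blast intro: continuous_on_subset)+
    show "(?q has_derivative (\<lambda>e. fst e * fx (x, v) + snd e * fv (x, v))) (at (x, v))"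
      if "x \<in> {a..b}" "v \<in> {c..d}" for x v
    proof (rule f_has_derivative)
      have "(x, v) \<in> ?B" using that by (simp add: cbox_Pair_eq)
      then show "snd (x, v) \<noteq> 0" using sub by blast
    qed
  qed (rule c\<phi> D | simp add: \<phi> bump_eq_0)+
  also have "\<dots> = 0" by (simp add: \<phi> bump_eq_0)
  finally have "integral ?B (\<lambda>p. ?G p + \<phi> p * P p) = 0" by (simp add: P_def)
  then have "integral ?B (\<lambda>p. \<phi> p * P p) = 0"
    using integral_add[OF has_integral_integrable[OF IG] integrable_continuous[OF c\<phi>P]]
      integral_unique[OF IG] by simp
  then have "((\<lambda>p. \<phi> p * P p) has_integral 0) ?B"
    using integrable_continuous[OF c\<phi>P] by (metis has_integral_integral)
  from has_integral_mult_left[OF this, of "P p0"]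
  have I0: "((\<lambda>p. \<phi> p * P p * P p0) has_integral 0) ?B" by simp
  have "\<phi> p0 * P p0 * P p0 = 0"
  proof (rule has_integral_0_cbox_imp_0[OF _ _ I0])
    show "continuous_on ?B (\<lambda>p. \<phi> p * P p * P p0)"
      by (intro continuous_intros c\<phi>P)
    show "0 \<le> \<phi> p * P p * P p0" if "p \<in> box (a, c) (b, d)" for p
    proof -
      have "p \<in> S" using that lu(1) box_subset_cbox by (auto simp: l u)
      then have "0 < P p * P p0" by (auto simp: S_def)
      then show ?thesis by (simp add: \<phi> bump_nonneg mult.assoc)
    qed
    show "box (a, c) (b, d) \<noteq> {}" using lu(2) l u by auto
    show "p0 \<in> ?B" using lu(2) box_subset_cbox by (auto simp: l u)
  qed
  moreover have "\<phi> p0 > 0" using p0box by (simp add: \<phi> bump_pos_iff)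
  ultimately show False using P0 by simp
qed

text \<open>Condition (i) without the enumeration of components: \<open>x\<close> and \<open>y\<close> lie in the same component of
  \<open>{U < h}\<close> iff the segment between them is contained in it.\<close>

definition constant_on_levels :: bool where
  "constant_on_levels \<longleftrightarrow> (\<forall>s\<in>{-1, 1}. \<forall>x y h. (\<forall>z\<in>closed_segment x y. U z < h) \<longrightarrow>
     f x (s * sqrt (2 * (h - U x))) = f y (s * sqrt (2 * (h - U y))))"

text \<open>Differentiation of w^2/2 + U = h along the curve. The condition \<open>s * s = 1\<close>
  covers both branches and makes \<open>s\<close> its own inverse, which is how \<open>s\<close>
  moves into the denominator.\<close>

lemma speed_derivative:
  assumes "U x < h" "s * s = (1::real)"
  shows "((\<lambda>x. s * sqrt (2 * (h - U x))) has_real_derivative - U' x / (s * sqrt (2 * (h - U x)))) (at x)"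
proof -
  have s: "inverse s = s" using assms(2) by (metis inverse_unique)
  have d: "((\<lambda>x. 2 * (h - U x)) has_real_derivative 2 * (0 - U' x)) (at x)"
    by (intro DERIV_cmult DERIV_diff DERIV_const U_deriv)
  have "((\<lambda>x. s * sqrt (2 * (h - U x))) has_real_derivative
      s * (inverse (sqrt (2 * (h - U x))) / 2 * (2 * (0 - U' x)))) (at x)"
    by (rule DERIV_cmult[OF DERIV_chain2[OF DERIV_real_sqrt d]]) (use assms(1) in simp)
  moreover have "s * (inverse (sqrt (2 * (h - U x))) / 2 * (2 * (0 - U' x)))
      = - U' x / (s * sqrt (2 * (h - U x)))"
    unfolding divide_inverse inverse_mult_distrib s by simp
  ultimately show ?thesis by simp
qed

lemma transport_constant_on_levels:
  assumes "\<And>p. snd p \<noteq> 0 \<Longrightarrow> snd p * fx p = U' (fst p) * fv p"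
  shows constant_on_levels
  unfolding constant_on_levels_def
proof (intro ballI allI impI)
  fix s x y h :: real assume s: "s \<in> {-1, 1}" and less: "\<forall>z\<in>closed_segment x y. U z < h"
  let ?w = "\<lambda>x. s * sqrt (2 * (h - U x))"
  have "((\<lambda>x. f x (?w x)) has_real_derivative 0) (at z within closed_segment x y)"
    if "z \<in> closed_segment x y" for z
  proof -
    have Uz: "U z < h" using less that by blast
    then have wz: "?w z \<noteq> 0" using s by auto
    have "fx (z, ?w z) + - U' z / ?w z * fv (z, ?w z) = 0"
      using assms[of "(z, ?w z)"] wz by (simp add: field_simps)
    then show ?thesis
      using f_has_real_derivative_along[OF speed_derivative[OF Uz, of s] wz] s
      by (auto intro: has_field_derivative_at_within)
  qed
  then obtain c where "\<And>z. z \<in> closed_segment x y \<Longrightarrow> f z (?w z) = c"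
    using has_field_derivative_zero_constant[of "closed_segment x y" "\<lambda>x. f x (?w x)"]
      convex_closed_segment by blast
  then show "f x (?w x) = f y (?w y)" by simp
qed

lemma constant_on_levelsD:
  assumes constant_on_levels and "v \<noteq> 0" and "\<And>z. z \<in> closed_segment x y \<Longrightarrow> U z < v\<^sup>2 / 2 + U x"
  shows "f x v = f y (sgn v * sqrt (2 * (v\<^sup>2 / 2 + U x - U y)))"
proof -
  have "sgn v \<in> {-1, 1}" using assms(2) by (simp add: sgn_if)
  then have "f x (sgn v * sqrt (2 * (v\<^sup>2 / 2 + U x - U x))) = f y (sgn v * sqrt (2 * (v\<^sup>2 / 2 + U x - U y)))"
    using assms(1,3) unfolding constant_on_levels_def by blast
  then show ?thesis by (simp add: sgn_mult_abs)
qed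

text \<open>Condition (iii) at one point with \<open>f\<close> itself in place of the profiles. At a
  critical point of \<open>U\<close> both limits are 0 and it holds trivially.\<close>

definition matching_limits :: "real \<Rightarrow> bool" where
  "matching_limits x \<longleftrightarrow> (\<exists>L. ((\<lambda>v. U' x * f x v) \<longlongrightarrow> L) (at_right 0) \<and> ((\<lambda>v. U' x * f x v) \<longlongrightarrow> L) (at_left 0))"

text \<open>The conclusion holds at every point. Where \<open>U' x0 \<noteq> 0\<close>, both halves
  of \<open>f\<close> near \<open>x0\<close> are functions of the energy alone, differentiable at
  the energy \<open>U x0\<close>. A function of the energy solves the transport equation, so Green's
  formula on each half box has no interior term; what remains is the integral along v = 0 of the
  jump \<open>m\<close> against a bump.\<close>

lemma weak_solution_matching_limits:
  assumes w: weak_solution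
  shows "matching_limits x0"
proof (cases "U' x0 = 0")
  case True
  then show ?thesis by (auto simp: matching_limits_def)
next
  case False
  have lev: constant_on_levels
    by (rule transport_constant_on_levels[OF weak_solution_transport[OF w]])
  \<comment> \<open>\<open>\<sigma>\<close> points uphill at \<open>x0\<close>: in the coordinate
    \<open>t\<close> given by \<open>x = x0 + \<sigma> * t\<close>, \<open>U\<close> increases near
    0 whatever the sign of \<open>U' x0\<close>.\<close>
  define \<sigma> where "\<sigma> = sgn (U' x0)"
  have \<sigma>: "\<sigma> * \<sigma> = 1" "\<sigma> \<noteq> 0" "\<sigma> * U' x0 > 0" "\<bar>\<sigma>\<bar> = 1"
    using False by (auto simp: \<sigma>_def sgn_if)
  have "open ((\<lambda>x. \<sigma> * U' x) -` {0<..})"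
    by (rule open_vimage) (auto intro!: continuous_intros U'_cont)
  then obtain \<delta>0 where "\<delta>0 > 0" and \<delta>0: "\<And>x. \<bar>x - x0\<bar> < \<delta>0 \<Longrightarrow> \<sigma> * U' x > 0"
    using \<sigma>(3) unfolding open_dist dist_real_def by fastforce
  \<comment> \<open>Half the radius makes the sign of \<open>U'\<close> available on the closed
    interval, endpoints included.\<close>
  define \<delta> where "\<delta> = \<delta>0 / 2"
  have \<delta>: "\<delta> > 0" "\<And>x. \<bar>x - x0\<bar> \<le> \<delta> \<Longrightarrow> \<sigma> * U' x > 0"
    using \<open>\<delta>0 > 0\<close> \<delta>0 by (auto simp: \<delta>_def)
  have mono: "U (x0 + \<sigma> * s) < U (x0 + \<sigma> * t)" if "- \<delta> \<le> s" "s < t" "t \<le> \<delta>" for s t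
  proof (rule DERIV_pos_imp_increasing[OF that(2)])
    fix r assume r: "s \<le> r" "r \<le> t"
    have "((\<lambda>r. U (x0 + \<sigma> * r)) has_real_derivative U' (x0 + \<sigma> * r) * \<sigma>) (at r)"
      by (rule DERIV_chain2[OF U_deriv]) (auto intro!: derivative_eq_intros)
    moreover have "U' (x0 + \<sigma> * r) * \<sigma> > 0"
      using \<delta>(2)[of "x0 + \<sigma> * r"] r that \<sigma>(4) by (simp add: abs_mult mult.commute)
    ultimately show "\<exists>y. ((\<lambda>r. U (x0 + \<sigma> * r)) has_real_derivative y) (at r) \<and> y > 0" by blast
  qed
  \<comment> \<open>Moving the base point down the slope of \<open>U\<close> to \<open>x1\<close> makes the speed at energy \<open>U x0\<close> positive
    there, so that the profiles \<open>Ft (\<plusminus>1)\<close> below are smooth across that energy.\<close>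
  define x1 where "x1 = x0 + \<sigma> * (- \<delta>)"
  have U1: "U x1 < U x" if "\<bar>x - x0\<bar> < \<delta>" for x
  proof -
    have "x = x0 + \<sigma> * (\<sigma> * (x - x0))" using \<sigma>(1) by (simp flip: mult.assoc)
    moreover have "\<bar>\<sigma> * (x - x0)\<bar> < \<delta>" using that \<sigma>(4) by (simp add: abs_mult)
    ultimately show ?thesis
      using mono[of "- \<delta>" "\<sigma> * (x - x0)"] \<delta>(1) by (simp add: x1_def)
  qed
  have seg: "U z \<le> U x" if x: "\<bar>x - x0\<bar> < \<delta>" and zx: "z \<in> closed_segment x x1" for x z
  proof -
    \<comment> \<open>In this coordinate the segment from \<open>x\<close> to \<open>x1\<close> runs
      from \<open>t\<close> down to \<open>- \<delta>\<close>, hence downhill.\<close>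
    define t where "t = \<sigma> * (x - x0)"
    have t: "x = x0 + \<sigma> * t" "\<bar>t\<bar> < \<delta>"
      using x \<sigma>(1,4) by (simp_all add: t_def abs_mult flip: mult.assoc)
    obtain u where u: "0 \<le> u" "u \<le> 1" "z = (1 - u) *\<^sub>R x + u *\<^sub>R x1"
      using zx by (auto simp: in_segment)
    have z: "z = x0 + \<sigma> * ((1 - u) * t + u * (- \<delta>))"
      using u(3) by (simp add: t(1) x1_def algebra_simps)
    have "0 \<le> u * (t + \<delta>)" "u * (t + \<delta>) \<le> 1 * (t + \<delta>)"
      using u(1,2) t(2) mult_right_mono[of u 1 "t + \<delta>"] by (auto intro!: mult_nonneg_nonneg)
    then have "- \<delta> \<le> (1 - u) * t + u * (- \<delta>)" "(1 - u) * t + u * (- \<delta>) \<le> t"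
      by (auto simp: algebra_simps)
    then show ?thesis
      using mono[of "(1 - u) * t + u * (- \<delta>)" t] t z by force
  qed
  define Ft where "Ft = (\<lambda>s h. f x1 (s * sqrt (2 * (h - U x1))))"
  have f_Ft: "f x v = Ft (sgn v) (v\<^sup>2 / 2 + U x)" if "\<bar>x - x0\<bar> < \<delta>" "v \<noteq> 0" for x v
    unfolding Ft_def
  proof (rule constant_on_levelsD[OF lev that(2)])
    fix z assume "z \<in> closed_segment x x1"
    then have "U z \<le> U x" using seg[OF that(1)] by blast
    moreover have "v\<^sup>2 > 0" using that(2) by simp
    ultimately show "U z < v\<^sup>2 / 2 + U x" by linarith
  qed
  define Ft' where "Ft' = (\<lambda>s h. fv (x1, s * sqrt (2 * (h - U x1))) * (s / sqrt (2 * (h - U x1))))"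
  have dFt: "(Ft s has_real_derivative Ft' s h) (at h)" if "s \<in> {-1, 1}" "U x1 < h" for s h
  proof -
    have d2: "((\<lambda>h. 2 * (h - U x1)) has_real_derivative 2 * (1 - 0)) (at h)"
      by (intro DERIV_cmult DERIV_diff DERIV_const DERIV_ident)
    have "((\<lambda>h. s * sqrt (2 * (h - U x1))) has_real_derivative
        s * (inverse (sqrt (2 * (h - U x1))) / 2 * (2 * (1 - 0)))) (at h)"
      by (rule DERIV_cmult[OF DERIV_chain2[OF DERIV_real_sqrt d2]]) (use that(2) in simp)
    moreover have "s * (inverse r / 2 * (2 * (1 - 0))) = s / r" for r :: real
      unfolding divide_inverse by simp
    ultimately have d: "((\<lambda>h. s * sqrt (2 * (h - U x1))) has_real_derivative s / sqrt (2 * (h - U x1))) (at h)"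
      by (simp only:)
    have w: "s * sqrt (2 * (h - U x1)) \<noteq> 0" using that by auto
    have "((\<lambda>h. case (x1, s * sqrt (2 * (h - U x1))) of (x, v) \<Rightarrow> f x v) has_derivative
        (\<lambda>e. fst (0 :: real, s / sqrt (2 * (h - U x1)) * e) * fx (x1, s * sqrt (2 * (h - U x1)))
          + snd (0 :: real, s / sqrt (2 * (h - U x1)) * e) * fv (x1, s * sqrt (2 * (h - U x1))))) (at h)"
      by (rule has_derivative_compose[OF has_derivative_Pair[OF has_derivative_const
              d[unfolded has_field_derivative_def]] f_has_derivative])
        (use w in simp)
    then show ?thesis
      unfolding has_field_derivative_def Ft'_def Ft_def
      by (rule has_derivative_eq_rhs[OF back_subst[of "\<lambda>g. (g has_derivative _) _"]]) (auto simp: algebra_simps)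
  qed
  have cFt': "continuous_on {U x1<..} (Ft' s)" if "s \<in> {-1, 1}" for s
    unfolding Ft'_def
    by (intro continuous_intros continuous_on_compose2[OF fv_cont]) (use that in auto)
  have cFt: "continuous_on {U x1<..} (Ft s)" if "s \<in> {-1, 1}" for s
    using dFt[OF that] by (intro DERIV_continuous_on) (auto intro: has_field_derivative_at_within)
  have lim: "((\<lambda>v. U' x0 * f x0 v) \<longlongrightarrow> U' x0 * Ft s (U x0)) (at 0 within S)"
    if s: "s \<in> {-1, 1}" and S: "\<And>v. v \<in> S \<Longrightarrow> sgn v = s" for s S
  proof -
    have "isCont (Ft s) (U x0)"
      using dFt[OF s U1[of x0]] \<delta>(1) DERIV_isCont by simp
    moreover have "((\<lambda>v. v\<^sup>2 / 2 + U x0) \<longlongrightarrow> 0\<^sup>2 / 2 + U x0) (at 0 within S)"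
      by (intro tendsto_intros) simp
    ultimately have "((\<lambda>v. Ft s (v\<^sup>2 / 2 + U x0)) \<longlongrightarrow> Ft s (U x0)) (at 0 within S)"
      using isCont_tendsto_compose by fastforce
    then have "((\<lambda>v. f x0 v) \<longlongrightarrow> Ft s (U x0)) (at 0 within S)"
      by (rule Lim_transform_eventually)
        (use S f_Ft[of x0] \<delta>(1) in \<open>auto simp: eventually_at_filter\<close>)
    then show ?thesis by (intro tendsto_intros)
  qed
  \<comment> \<open>The jump of \<open>U' f\<close> across v = 0; the energy of the point
    \<open>(x, 0)\<close> is \<open>U x\<close>.\<close>
  define m where "m = (\<lambda>x. U' x * (Ft 1 (U x) - Ft (-1) (U x)))"
  have "m x0 = 0"
  proof (rule ccontr)
    assume m0: "m x0 \<noteq> 0"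
    have cm: "continuous_on {x0 - \<delta><..<x0 + \<delta>} m"
      unfolding m_def
      by (intro continuous_intros continuous_on_subset[OF U'_cont] U_cont
          continuous_on_compose2[OF cFt]) (auto intro!: U1)
    define S where "S = {x0 - \<delta><..<x0 + \<delta>} \<inter> (\<lambda>x. m x * m x0) -` {0<..}"
    have "open S"
      unfolding S_def
      by (rule continuous_open_preimage) (auto intro!: continuous_intros cm)
    moreover have "x0 \<in> S" using m0 \<delta>(1) by (auto simp: S_def zero_less_mult_iff)
    ultimately obtain a b where ab': "cbox a b \<subseteq> S" "x0 \<in> box a b"
      using open_contains_cbox by metis
    then have ab: "a < x0" "x0 < b" "a < b" by auto
    have inS: "\<bar>x - x0\<bar> < \<delta>" "m x * m x0 > 0" if "x \<in> {a..b}" for x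
    proof -
      have "x \<in> S" using ab'(1) that by auto
      then show "\<bar>x - x0\<bar> < \<delta>" "m x * m x0 > 0" by (auto simp: S_def abs_less_iff)
    qed
    obtain \<phi> \<phi>x \<phi>v where D: "\<And>p. (\<phi> has_derivative (\<lambda>e. fst e * \<phi>x p + snd e * \<phi>v p)) (at p)"
      and c\<phi>: "continuous_on UNIV \<phi>" "continuous_on UNIV \<phi>x" "continuous_on UNIV \<phi>v"
      and \<phi>: "\<And>p. \<phi> p = bump 1 a b (fst p) * bump 1 (-1) 1 (snd p)"
      and I: "((\<lambda>p. f0 p * (snd p * \<phi>x p - U' (fst p) * \<phi>v p)) has_integral 0) (cbox (a, -1) (b, 1))"
      by (rule weak_solution_bump[OF w \<open>a < b\<close>, of "-1" 1]) auto
    let ?F = "\<lambda>p. f0 p * (snd p * \<phi>x p - U' (fst p) * \<phi>v p)"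
    define H where "H = (\<lambda>p. (snd p)\<^sup>2 / 2 + U (fst p))"
    have dH: "(H has_derivative (\<lambda>e. fst e * U' (fst p) + snd e * snd p)) (at p)" for p
    proof -
      have "((\<lambda>p :: real \<times> real. (snd p)\<^sup>2 / 2) has_derivative (\<lambda>e. snd e * snd p)) (at p)"
        by (auto intro!: derivative_eq_intros)
      from has_derivative_add[OF DERIV_compose_FDERIV[OF U_deriv has_derivative_fst[OF has_derivative_ident]] this]
      show ?thesis by (simp add: H_def add.commute)
    qed
    \<comment> \<open>The sign condition exempts v = 0, so that each half box may have an edge on
      that line. There \<open>f0\<close> and the profile may differ, but only on a null set.\<close>
    have half: "integral (cbox (a, c) (b, d)) ?F
        = integral {a..b} (\<lambda>x. U' x * (Ft s (H (x, c)) * \<phi> (x, c) - Ft s (H (x, d)) * \<phi> (x, d)))"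
      if s: "s \<in> {-1, 1}" and cd: "c \<le> d" and sg: "\<And>v. v \<in> {c..d} \<Longrightarrow> v \<noteq> 0 \<Longrightarrow> sgn v = s" for s c d
    proof -
      let ?q = "\<lambda>p. Ft s (H p)" and ?qx = "\<lambda>p. Ft' s (H p) * U' (fst p)" and ?qv = "\<lambda>p. Ft' s (H p) * snd p"
      have H1: "U x1 < H p" if "p \<in> cbox (a, c) (b, d)" for p
      proof -
        have "fst p \<in> {a..b}" using that by (cases p) (simp add: cbox_Pair_eq)
        then have "U x1 < U (fst p)" by (rule U1[OF inS(1)])
        moreover have "0 \<le> (snd p)\<^sup>2 / 2" by simp
        ultimately show ?thesis unfolding H_def by linarith
      qed
      have cH: "continuous_on (cbox (a, c) (b, d)) H"
        unfolding H_def by (intro continuous_intros continuous_on_compose2[OF U_cont[of UNIV]]) auto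
      have sub: "H ` cbox (a, c) (b, d) \<subseteq> {U x1<..}" using H1 by auto
      \<comment> \<open>The added term is identically 0, as \<open>?qx\<close> and
        \<open>?qv\<close> are the partial derivatives of a function of \<open>H\<close>; it is
        inserted to match \<open>box_green\<close>.\<close>
      have "integral (cbox (a, c) (b, d)) ?F
          = integral (cbox (a, c) (b, d)) (\<lambda>p. ?q p * (snd p * \<phi>x p - U' (fst p) * \<phi>v p)
              + \<phi> p * (snd p * ?qx p - U' (fst p) * ?qv p))"
      proof (rule integral_spike)
        show "negligible {p :: real \<times> real. snd p = 0}"
          using negligible_standard_hyperplane[of "(0::real, 1::real)" 0]
          by (simp add: Basis_prod_def inner_prod_def)
        fix p assume p: "p \<in> cbox (a, c) (b, d) - {p. snd p = 0}"
        then have "f0 p = ?q p"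
          using f_Ft[of "fst p" "snd p"] sg[of "snd p"] inS(1)[of "fst p"]
          by (cases p) (auto simp: f0_def H_def cbox_Pair_eq)
        then show "?q p * (snd p * \<phi>x p - U' (fst p) * \<phi>v p)
              + \<phi> p * (snd p * ?qx p - U' (fst p) * ?qv p) = ?F p"
          by (simp add: algebra_simps)
      qed
      also have "\<dots> = integral {a..b} (\<lambda>x. U' x * (?q (x, c) * \<phi> (x, c) - ?q (x, d) * \<phi> (x, d)))"
      proof (rule box_green[OF less_imp_le[OF \<open>a < b\<close>] cd U'_cont])
        show "continuous_on (cbox (a, c) (b, d)) ?q"
          by (rule continuous_on_compose2[OF cFt[OF s] cH sub])
        show "continuous_on (cbox (a, c) (b, d)) ?qx" "continuous_on (cbox (a, c) (b, d)) ?qv"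
          by (intro continuous_intros continuous_on_compose2[OF cFt'[OF s] cH sub] continuous_on_compose2[OF U'_cont]; simp)+
        show "(?q has_derivative (\<lambda>e. fst e * ?qx (x, v) + snd e * ?qv (x, v))) (at (x, v))"
          if "x \<in> {a..b}" "v \<in> {c..d}" for x v
          by (rule has_derivative_eq_rhs[OF DERIV_compose_FDERIV[OF dFt[OF s H1] dH]])
            (use that in \<open>auto simp: algebra_simps cbox_Pair_eq\<close>)
      qed (rule c\<phi> D | simp add: \<phi> bump_eq_0)+
      finally show ?thesis .
    qed
    have "integral (cbox (a, -1) (b, 1)) ?F
        = integral (cbox (a, -1) (b, 1) \<inter> {p. p \<bullet> (0, 1) \<le> 0}) ?F + integral (cbox (a, -1) (b, 1) \<inter> {p. p \<bullet> (0, 1) \<ge> 0}) ?F"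
      by (rule integral_split[OF has_integral_integrable[OF I]]) (simp add: Basis_prod_def)
    moreover have "cbox (a, -1) (b, 1 :: real) \<inter> {p. p \<bullet> (0, 1) \<le> 0} = cbox (a, -1) (b, 0)"
      "cbox (a, -1) (b, 1 :: real) \<inter> {p. p \<bullet> (0, 1) \<ge> 0} = cbox (a, 0) (b, 1)"
      by (auto simp: cbox_Pair_eq inner_prod_def)
    ultimately have "integral (cbox (a, -1) (b, 0)) ?F + integral (cbox (a, 0) (b, 1)) ?F = 0"
      using integral_unique[OF I] by simp
    \<comment> \<open>The bump vanishes at v = -1 and v = 1, so only the two edges on v = 0 survive.
      They carry opposite signs, being the upper edge of one box and the lower edge of the
      other.\<close>
    then have J: "integral {a..b} (\<lambda>x. - (U' x * (Ft (-1) (U x) * \<phi> (x, 0))))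
        + integral {a..b} (\<lambda>x. U' x * (Ft 1 (U x) * \<phi> (x, 0))) = 0"
      using half[of "-1" "-1" 0] half[of 1 0 1] by (simp add: H_def \<phi> bump_eq_0)
    have cg: "continuous_on {a..b} (\<lambda>x. U' x * (Ft s (U x) * \<phi> (x, 0)))" if "s \<in> {-1, 1}" for s
      by (intro continuous_intros continuous_on_subset[OF U'_cont] U_cont continuous_on_compose2[OF c\<phi>(1)]
          continuous_on_compose2[OF cFt[OF that]]) (auto intro!: U1 inS(1))
    have I0: "integral {a..b} (\<lambda>x. - (U' x * (Ft (-1) (U x) * \<phi> (x, 0))) + U' x * (Ft 1 (U x) * \<phi> (x, 0))) = 0"
      using J integral_add[OF integrable_continuous_real[OF continuous_on_minus[OF cg[of "-1"]]]
          integrable_continuous_real[OF cg[of 1]]] by simp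
    have eq: "(\<lambda>x. - (U' x * (Ft (-1) (U x) * \<phi> (x, 0))) + U' x * (Ft 1 (U x) * \<phi> (x, 0))) = (\<lambda>x. \<phi> (x, 0) * m x)"
      by (auto simp: m_def algebra_simps)
    have cm': "continuous_on {a..b} (\<lambda>x. \<phi> (x, 0) * m x)"
      by (intro continuous_intros continuous_on_compose2[OF c\<phi>(1)] continuous_on_subset[OF cm])
        (use ab'(1) in \<open>auto simp: S_def\<close>)
    have "((\<lambda>x. \<phi> (x, 0) * m x) has_integral 0) {a..b}"
      using I0 integrable_continuous_real[OF cm'] unfolding eq by (metis has_integral_integral)
    from has_integral_mult_left[OF this, of "m x0"]
    have I1: "((\<lambda>x. \<phi> (x, 0) * m x * m x0) has_integral 0) (cbox a b)" by simp
    have "\<phi> (x0, 0) * m x0 * m x0 = 0"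
    proof (rule has_integral_0_cbox_imp_0[OF _ _ I1])
      show "continuous_on (cbox a b) (\<lambda>x. \<phi> (x, 0) * m x * m x0)"
        using cm' by (auto intro!: continuous_intros)
      show "0 \<le> \<phi> (x, 0) * m x * m x0" if "x \<in> box a b" for x
        using inS(2)[of x] that by (simp add: \<phi> bump_nonneg mult.assoc)
    qed (use ab in auto)
    moreover have "\<phi> (x0, 0) > 0" using ab by (simp add: \<phi> bump_pos_iff)
    ultimately show False using m0 by simp
  qed
  then have "U' x0 * Ft 1 (U x0) = U' x0 * Ft (-1) (U x0)"
    by (simp add: m_def right_diff_distrib)
  then show ?thesis
    unfolding matching_limits_def
    using lim[of 1 "{0<..}"] lim[of "-1" "{..<0}"] by auto
qed

end

section \<open>Energy slices\<close>

text \<open>Sard's theorem on the line. \<open>baby_Sard\<close> speaks of vectors, so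
  \<open>U\<close> is carried to \<open>real^1\<close> by \<open>vec\<close> and back by the first
  coordinate; a zero derivative has rank 0, which is below the dimension 1.\<close>

lemma negligible_critical_values:
  fixes U :: "real \<Rightarrow> real"
  assumes "\<And>x. x \<in> S \<Longrightarrow> (U has_real_derivative 0) (at x)"
  shows "negligible (U ` S)"
proof -
  let ?F = "\<lambda>y :: real^1. vec (U (y $ 1)) :: real^1"
  have "negligible (?F ` (vec ` S))"
  proof (rule baby_Sard)
    fix y :: "real^1" assume "y \<in> vec ` S"
    then have "y $ 1 \<in> S" by auto
    then have "(U has_derivative (\<lambda>e. 0)) (at (y $ 1))"
      using assms by (fastforce simp: has_field_derivative_def lambda_zero)
    then have "((\<lambda>y :: real^1. U (y $ 1)) has_derivative (\<lambda>e. 0)) (at y)"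
      using has_derivative_compose[OF bounded_linear_imp_has_derivative[OF bounded_linear_vec_nth]] by fastforce
    then have "((\<lambda>y. U (y $ 1) *\<^sub>R (vec 1 :: real^1)) has_derivative (\<lambda>e. 0)) (at y)"
      using has_derivative_scaleR_left by fastforce
    moreover have "(\<lambda>y :: real^1. U (y $ 1) *\<^sub>R (vec 1 :: real^1)) = ?F"
      by (auto simp: vec_eq_iff)
    ultimately show "(?F has_derivative (\<lambda>e. 0)) (at y within vec ` S)"
      by (simp add: has_derivative_at_withinI)
    show "rank (matrix (\<lambda>e :: real^1. 0 :: real^1)) < CARD(1)"
    proof -
      have "matrix (\<lambda>e :: real^1. 0 :: real^1) = 0"
        by (simp add: matrix_def vec_eq_iff)
      then show ?thesis by simp
    qed
  qed simp
  then have "negligible ((\<lambda>y :: real^1. y $ 1) ` ?F ` (vec ` S))"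
    by (rule negligible_differentiable_image_negligible[rotated])
      (auto intro!: differentiable_on_def[THEN iffD2] linear_imp_differentiable bounded_linear.linear bounded_linear_vec_nth)
  moreover have "(\<lambda>y :: real^1. y $ 1) ` ?F ` (vec ` S) = U ` S"
    by (auto simp: image_image)
  ultimately show ?thesis by simp
qed

text \<open>The substitution h = v^2/2 + c with dh = v dv, so that \<open>Q\<close> at h is
  \<open>P v / v\<close>. Integrability of \<open>Q\<close> is a conclusion: the singularity of
  \<open>1 / v\<close> is absorbed by the Jacobian, and no bound on \<open>P\<close> near v = 0
  enters.\<close>

lemma energy_substitution_half_line:
  fixes P :: "real \<Rightarrow> real" and c :: real
  assumes P: "integrable lborel (\<lambda>v. indicator {0<..} v * P v)" and [measurable]: "P \<in> borel_measurable borel"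
  defines "Q \<equiv> \<lambda>h. if c < h then P (sqrt (2 * (h - c))) / sqrt (2 * (h - c)) else 0"
  shows "integrable lborel Q" and "(LINT h|lborel. Q h) = (LINT v|lborel. indicator {0<..} v * P v)"
proof -
  let ?g = "\<lambda>v. v\<^sup>2 / 2 + c"
  have [measurable]: "Q \<in> borel_measurable borel"
    unfolding Q_def by measurable
  have inj: "inj_on ?g {0<..}"
    by (auto simp: inj_on_def)
  have img: "?g ` {0<..} = {c<..}"
  proof (intro subset_antisym subsetI)
    fix h assume "h \<in> {c<..}"
    then have "h = ?g (sqrt (2 * (h - c)))" "sqrt (2 * (h - c)) > 0" by (auto simp: diff_divide_distrib)
    then show "h \<in> ?g ` {0<..}" by blast
  qed auto
  have der: "(?g has_field_derivative v) (at v within {0<..})" for v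
    by (auto intro!: derivative_eq_intros)
  have eq: "\<bar>v\<bar> * Q (?g v) = P v" if "v \<in> {0<..}" for v
    using that by (auto simp: Q_def)
  have lP: "set_integrable lebesgue {0<..} P"
    using P unfolding set_integrable_def real_scaleR_def
    by (subst integrable_completion) auto
  have ai: "(\<lambda>v. \<bar>v\<bar> * Q (?g v)) absolutely_integrable_on {0<..}"
    by (subst set_integrable_cong[OF refl refl eq]) (simp_all add: lP)
  have "integral {0<..} (\<lambda>v. \<bar>v\<bar> * Q (?g v)) = integral {0<..} P"
    by (rule integral_cong) (rule eq)
  then have Q: "Q absolutely_integrable_on {c<..}" "integral {c<..} Q = integral {0<..} P"
    using has_absolute_integral_change_of_variables_1'[OF _ der inj, of Q "integral {0<..} P"] ai
    unfolding img by auto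
  have indQ: "(\<lambda>h. indicator {c<..} h *\<^sub>R Q h) = Q"
    by (auto simp: Q_def indicator_def)
  have iQ: "integrable lebesgue Q"
    using Q(1) unfolding set_integrable_def indQ .
  then show "integrable lborel Q"
    by (subst (asm) integrable_completion) auto
  have "(LINT h|lborel. Q h) = (LINT h|lebesgue. Q h)"
    by (rule integral_completion[symmetric]) simp
  also have "\<dots> = integral {c<..} Q"
    using set_lebesgue_integral_eq_integral(2)[OF Q(1)] unfolding set_lebesgue_integral_def indQ .
  also have "\<dots> = (LINT v|lebesgue. indicator {0<..} v * P v)"
    using set_lebesgue_integral_eq_integral(2)[OF lP] Q(2)
    unfolding set_lebesgue_integral_def by simp
  also have "\<dots> = (LINT v|lborel. indicator {0<..} v * P v)"
    by (rule integral_completion) simp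
  finally show "(LINT h|lborel. Q h) = (LINT v|lborel. indicator {0<..} v * P v)" .
qed

text \<open>Reflection of the negative half-line. With \<open>P 0 = 0\<close> the splitting is an
  identity of functions; the application meets this condition because \<open>f0\<close> is 0 on v =
  0.\<close>

lemma integral_fold_half_line:
  fixes P :: "real \<Rightarrow> real"
  assumes P: "integrable lborel P" and 0: "P 0 = 0"
  shows "integrable lborel (\<lambda>v. indicator {0<..} v * (P v + P (- v)))"
    and "(LINT v|lborel. indicator {0<..} v * (P v + P (- v))) = (LINT v|lborel. P v)"
proof -
  have i1: "integrable lborel (\<lambda>v. indicator {0<..} v * P v)"
    using integrable_mult_indicator[OF _ P, of "{0<..}"] by simp
  have i2: "integrable lborel (\<lambda>v. indicator {..<0} v * P v)"
    using integrable_mult_indicator[OF _ P, of "{..<0}"] by simp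
  have r: "(\<lambda>v. indicator {..<0} (0 + - 1 * v) * P (0 + - 1 * v)) = (\<lambda>v :: real. indicator {0<..} v * P (- v))"
    by (auto simp: indicator_def)
  have i3: "integrable lborel (\<lambda>v. indicator {0<..} v * P (- v))"
    using lborel_integrable_real_affine[OF i2, of "-1" 0] unfolding r by simp
  show "integrable lborel (\<lambda>v. indicator {0<..} v * (P v + P (- v)))"
    using i1 i3 by (simp add: distrib_left)
  have e3: "(LINT v|lborel. indicator {..<0} v * P v) = (LINT v|lborel. indicator {0<..} v * P (- v))"
    using lborel_integral_real_affine[of "-1" "\<lambda>v. indicator {..<0} v * P v" 0] unfolding r by simp
  have "(LINT v|lborel. P v) = (LINT v|lborel. indicator {0<..} v * P v + indicator {..<0} v * P v)"
  proof (rule arg_cong[where f = "integral\<^sup>L lborel"], rule ext)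
    show "P v = indicator {0<..} v * P v + indicator {..<0} v * P v" for v
      using 0 by (cases "v = 0") (auto simp: indicator_def)
  qed
  then show "(LINT v|lborel. indicator {0<..} v * (P v + P (- v))) = (LINT v|lborel. P v)"
    using i1 i2 i3 e3 by (simp add: distrib_left)
qed

text \<open>The last claim is only an inequality because the contributions of v and -v may cancel.
  It bounds the slice in L^1, which is what justifies Fubini later.\<close>

lemma energy_substitution:
  fixes P :: "real \<Rightarrow> real" and c :: real
  assumes P: "integrable lborel P" and 0: "P 0 = 0"
  defines "Q \<equiv> \<lambda>h. if c < h then (P (sqrt (2 * (h - c))) + P (- sqrt (2 * (h - c)))) / sqrt (2 * (h - c)) else 0"
  shows "integrable lborel Q" and "(LINT h|lborel. Q h) = (LINT v|lborel. P v)"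
    and "(LINT h|lborel. \<bar>Q h\<bar>) \<le> (LINT v|lborel. \<bar>P v\<bar>)"
proof -
  have [measurable]: "P \<in> borel_measurable borel"
    using borel_measurable_integrable[OF P] by simp
  let ?R = "\<lambda>v. P v + P (- v)"
  note fold = integral_fold_half_line[OF P 0]
  show "integrable lborel Q" "(LINT h|lborel. Q h) = (LINT v|lborel. P v)"
    using energy_substitution_half_line[where c = c, OF fold(1)] fold(2) unfolding Q_def by auto
  have abs: "integrable lborel (\<lambda>v. indicator {0<..} v * \<bar>?R v\<bar>)"
    using integrable_abs[OF fold(1)] by (simp add: abs_mult)
  have absQ: "(\<lambda>h. \<bar>Q h\<bar>) = (\<lambda>h. if c < h then \<bar>?R (sqrt (2 * (h - c)))\<bar> / sqrt (2 * (h - c)) else 0)"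
    by (auto simp: Q_def)
  have fold': "integrable lborel (\<lambda>v. indicator {0<..} v * (\<bar>P v\<bar> + \<bar>P (- v)\<bar>))"
    "(LINT v|lborel. indicator {0<..} v * (\<bar>P v\<bar> + \<bar>P (- v)\<bar>)) = (LINT v|lborel. \<bar>P v\<bar>)"
    using integral_fold_half_line[OF integrable_abs[OF P]] 0 by auto
  have "(LINT h|lborel. \<bar>Q h\<bar>) = (LINT v|lborel. indicator {0<..} v * \<bar>?R v\<bar>)"
    unfolding absQ by (rule energy_substitution_half_line(2)[OF abs]) simp
  also have "\<dots> \<le> (LINT v|lborel. indicator {0<..} v * (\<bar>P v\<bar> + \<bar>P (- v)\<bar>))"
    by (rule integral_mono[OF abs fold'(1)]) (auto simp: indicator_def)
  finally show "(LINT h|lborel. \<bar>Q h\<bar>) \<le> (LINT v|lborel. \<bar>P v\<bar>)"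
    using fold'(2) by simp
qed

text \<open>The endpoints lie outside \<open>A\<close> by maximality: adjoining one of them to the
  component would leave it connected. Hence each endpoint is either a turning point or lies outside
  the support of the test function when this is applied.\<close>

lemma bounded_open_component_interval:
  fixes A :: "real set"
  assumes "open A" "bounded A" "C \<in> components A"
  obtains a b where "a < b" "C = {a<..<b}" "a \<notin> A" "b \<notin> A"
proof -
  have C: "open C" "connected C" "C \<noteq> {}" "C \<subseteq> A"
    using assms open_components in_components_connected in_components_nonempty in_components_subset by blast+
  have bd: "bdd_below C" "bdd_above C"
    using bounded_subset[OF assms(2) C(4)] by (auto intro: bounded_imp_bdd_below bounded_imp_bdd_above)
  define a where "a = Inf C"
  define b where "b = Sup C"
  have sub: "{a<..<b} \<subseteq> C"
  proof
    fix x assume "x \<in> {a<..<b}"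
    then obtain y z where "y \<in> C" "y < x" "z \<in> C" "x < z"
      using cInf_less_iff[OF C(3) bd(1)] less_cSup_iff[OF C(3) bd(2)] by (auto simp: a_def b_def)
    then show "x \<in> C"
      using connectedD_interval[OF C(2), of y z x] by auto
  qed
  have nC: "a \<notin> C \<and> b \<notin> C"
  proof (intro conjI notI)
    assume "a \<in> C"
    then obtain e where "e > 0" "cball a e \<subseteq> C" using C(1) open_contains_cball by blast
    then have "a - e \<in> C" by (auto simp: dist_real_def)
    from cInf_lower[OF this bd(1)] show False using \<open>e > 0\<close> by (simp add: a_def)
  next
    assume "b \<in> C"
    then obtain e where "e > 0" "cball b e \<subseteq> C" using C(1) open_contains_cball by blast
    then have "b + e \<in> C" by (auto simp: dist_real_def)
    from cSup_upper[OF this bd(2)] show False using \<open>e > 0\<close> by (simp add: b_def)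
  qed
  have "C \<subseteq> {a<..<b}"
  proof
    fix x assume x: "x \<in> C"
    then have "a \<le> x" "x \<le> b" using cInf_lower[OF _ bd(1)] cSup_upper[OF _ bd(2)] by (auto simp: a_def b_def)
    moreover have "a \<noteq> x" "x \<noteq> b" using x nC by auto
    ultimately show "x \<in> {a<..<b}" by simp
  qed
  with sub have Ceq: "C = {a<..<b}" by blast
  then have ab: "a < b" using C(3) by auto
  have out: "e \<notin> A" if "e = a \<or> e = b" for e
  proof
    assume "e \<in> A"
    have "connected (insert e C)"
      by (rule connected_intermediate_closure[OF C(2)])
        (use that ab in \<open>auto simp: Ceq closure_greaterThanLessThan\<close>)
    then have "insert e C \<subseteq> C"
      using components_maximal[OF assms(3), of "insert e C"] \<open>e \<in> A\<close> C(3,4) by auto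
    then show False using that Ceq by auto
  qed
  show thesis using that[OF ab Ceq] out by blast
qed

text \<open>The components of an open set are open and disjoint, hence countably many, and countable
  additivity applies.\<close>

lemma integral_components_eq_0:
  fixes F :: "real \<Rightarrow> real"
  assumes A: "open A" and F: "set_integrable M A F" and M: "sets M = sets borel"
    and 0: "\<And>C. C \<in> components A \<Longrightarrow> (LINT x:C|M. F x) = 0"
  shows "(LINT x:A|M. F x) = 0"
proof -
  have opC: "open C" if "C \<in> components A" for C
    using open_components[OF A that] .
  have cnt: "countable (components A)"
    by (rule countable_disjoint_open_subsets)
      (use opC pairwise_disjoint_components[of A] in \<open>auto simp: disjnt_def pairwise_def\<close>)
  \<comment> \<open>Numbers that encode no component give the empty set, so that the family is
    indexed by all of \<open>nat\<close>.\<close>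
  define B where "B = (\<lambda>n. \<Union>{C \<in> components A. to_nat_on (components A) C = n})"
  have B: "B n = {} \<or> B n \<in> components A" for n
  proof (cases "\<exists>C\<in>components A. to_nat_on (components A) C = n")
    case True
    then obtain C where "C \<in> components A" "to_nat_on (components A) C = n" by blast
    then have "{C \<in> components A. to_nat_on (components A) C = n} = {C}"
      using inj_on_to_nat_on[OF cnt] by (auto dest: inj_onD)
    then show ?thesis using \<open>C \<in> components A\<close> by (simp add: B_def)
  qed (auto simp: B_def)
  have "(\<Union>n. B n) = \<Union> (components A)"
    unfolding B_def by blast
  then have U: "(\<Union>n. B n) = A"
    using Union_components[of A] by metis
  have "(LINT x:(\<Union>n. B n)|M. F x) = (\<Sum>n. (LINT x:(B n)|M. F x))"
  proof (rule lebesgue_integral_countable_add)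
    show "B n \<in> sets M" for n
      using B[of n] opC by (auto simp: M)
    show "B i \<inter> B j = {}" if "i \<noteq> j" for i j
      using that components_nonoverlap unfolding B_def by fastforce
  qed (use F U in simp)
  also have "(\<lambda>n. LINT x:(B n)|M. F x) = (\<lambda>n. 0)"
  proof
    show "(LINT x:(B n)|M. F x) = 0" for n
      using B[of n] 0 by (auto simp: set_lebesgue_integral_def)
  qed
  finally show ?thesis by (simp add: U)
qed

section \<open>Vanishing of almost every energy slice, and the converse implication\<close>

context phase_space
begin

definition transport_integrand :: "(real \<times> real \<Rightarrow> real) \<Rightarrow> (real \<times> real \<Rightarrow> real) \<Rightarrow> real \<times> real \<Rightarrow> real" where
  "transport_integrand \<phi>x \<phi>v p = f0 p * (snd p * \<phi>x p - U' (fst p) * \<phi>v p)"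

text \<open>The density of the \<open>v\<close>-integral in the variable \<open>h = v\<^sup>2 / 2 + U x\<close>, the contributions of \<open>v\<close> and
  \<open>- v\<close> being added: only their sum has vanishing boundary terms at a turning point.\<close>

definition energy_slice :: "(real \<times> real \<Rightarrow> real) \<Rightarrow> (real \<times> real \<Rightarrow> real) \<Rightarrow> real \<Rightarrow> real \<Rightarrow> real" where
  "energy_slice \<phi>x \<phi>v x h = (if U x < h
     then (transport_integrand \<phi>x \<phi>v (x, sqrt (2 * (h - U x)))
         + transport_integrand \<phi>x \<phi>v (x, - sqrt (2 * (h - U x)))) / sqrt (2 * (h - U x))
     else 0)"

text \<open>At \<open>e\<close> the speed tends to 0 and \<open>f\<close> need not be continuous, so
  its one-sided values are transported along the levels just above \<open>h\<close> to
  \<open>x\<close>. There the speed stays positive and \<open>f\<close> is continuous, so the limits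
  at \<open>e\<close> are the two values at \<open>x\<close>; a nonzero \<open>U' e\<close> can be
  cancelled.\<close>

lemma turning_point_match:
  assumes lev: constant_on_levels and e: "U e = h" "U' e \<noteq> 0" "matching_limits e"
    and seg: "\<And>z. z \<in> closed_segment x e \<Longrightarrow> z \<noteq> e \<Longrightarrow> U z < h" and "x \<noteq> e"
  shows "f x (sqrt (2 * (h - U x))) = f x (- sqrt (2 * (h - U x)))"
proof -
  have Ux: "U x < h" using seg[of x] \<open>x \<noteq> e\<close> by simp
  obtain L where L: "((\<lambda>v. U' e * f e v) \<longlongrightarrow> L) (at_right 0)" "((\<lambda>v. U' e * f e v) \<longlongrightarrow> L) (at_left 0)"
    using e(3) unfolding matching_limits_def by blast
  have fe: "f e v = f x (sgn v * sqrt (2 * (v\<^sup>2 / 2 + h - U x)))" if "v \<noteq> 0" for v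
  proof -
    have "f e v = f x (sgn v * sqrt (2 * (v\<^sup>2 / 2 + U e - U x)))"
    proof (rule constant_on_levelsD[OF lev that])
      fix z assume z: "z \<in> closed_segment e x"
      have "v\<^sup>2 / 2 > 0" using that by simp
      moreover have "U z \<le> U e"
        using seg[of z] z e(1) by (cases "z = e") (auto simp: closed_segment_commute)
      ultimately show "U z < v\<^sup>2 / 2 + U e" by linarith
    qed
    then show ?thesis by (simp add: e(1))
  qed
  have lim: "((\<lambda>v. U' e * f e v) \<longlongrightarrow> U' e * f x (s * sqrt (2 * (h - U x)))) (at 0 within S)"
    if s: "s \<in> {-1, 1}" and S: "\<And>v. v \<in> S \<Longrightarrow> sgn v = s" for s S
  proof -
    have "isCont (\<lambda>(x, v). f x v) (x, s * sqrt (2 * (h - U x)))"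
      by (rule has_derivative_continuous[OF f_has_derivative]) (use s Ux in auto)
    moreover have "((\<lambda>v. (x, s * sqrt (2 * (v\<^sup>2 / 2 + h - U x)))) \<longlongrightarrow> (x, s * sqrt (2 * (0\<^sup>2 / 2 + h - U x)))) (at 0 within S)"
      by (intro tendsto_intros) simp
    ultimately have "((\<lambda>v. f x (s * sqrt (2 * (v\<^sup>2 / 2 + h - U x)))) \<longlongrightarrow> f x (s * sqrt (2 * (h - U x)))) (at 0 within S)"
      using isCont_tendsto_compose[of _ "\<lambda>(x, v). f x v"] by fastforce
    then have "((\<lambda>v. f e v) \<longlongrightarrow> f x (s * sqrt (2 * (h - U x)))) (at 0 within S)"
      by (rule Lim_transform_eventually) (use S fe in \<open>auto simp: eventually_at_filter\<close>)
    then show ?thesis by (intro tendsto_intros)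
  qed
  have "U' e * f x (1 * sqrt (2 * (h - U x))) = L"
    by (rule tendsto_unique[OF _ lim L(1)]) auto
  moreover have "U' e * f x (-1 * sqrt (2 * (h - U x))) = L"
    by (rule tendsto_unique[OF _ lim L(2)]) auto
  ultimately have "f x (1 * sqrt (2 * (h - U x))) = f x (-1 * sqrt (2 * (h - U x)))"
    using e(2) by (metis mult_cancel_left)
  then show ?thesis by simp
qed

text \<open>The derivative of the speed may blow up at a turning point, so the fundamental theorem
  is used in the form that asks for a derivative only in the interior and for continuity up to the
  ends. The second alternative in \<open>ends\<close> covers endpoints that come from truncating to
  the support of \<open>\<phi>\<close>.\<close>

lemma energy_slice_integral_component:
  assumes lev: constant_on_levels and ab: "a < b"
    and D: "\<And>p. (\<phi> has_derivative (\<lambda>e. fst e * \<phi>x p + snd e * \<phi>v p)) (at p)"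
    and less: "\<And>x. x \<in> {a<..<b} \<Longrightarrow> U x < h"
    and ends: "\<And>e. e \<in> {a, b} \<Longrightarrow> (U e = h \<and> U' e \<noteq> 0 \<and> matching_limits e) \<or> (\<forall>v. \<phi> (e, v) = 0)"
  shows "((\<lambda>x. energy_slice \<phi>x \<phi>v x h) has_integral 0) {a..b}"
proof -
  define w where "w = (\<lambda>x. sqrt (2 * (h - U x)))"
  define m where "m = (a + b) / 2"
  have m: "m \<in> {a<..<b}" using ab by (simp add: m_def)
  have fw: "f x (s * w x) = f m (s * w m)" if "x \<in> {a<..<b}" "s \<in> {-1, 1}" for x s
  proof -
    have "closed_segment x m \<subseteq> {a<..<b}"
      by (rule closed_segment_subset[OF that(1) m convex_real_interval(8)])
    then have "\<forall>z\<in>closed_segment x m. U z < h" using less by blast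
    then show ?thesis
      using lev that(2) unfolding constant_on_levels_def w_def by blast
  qed
  define cp where "cp = f m (w m)"
  define cm where "cm = f m (- w m)"
  have fp: "f x (w x) = cp" "f x (- w x) = cm" if "x \<in> {a<..<b}" for x
    using fw[OF that, of 1] fw[OF that, of "-1"] by (simp_all add: cp_def cm_def)
  \<comment> \<open>The minus sign comes from the lower branch, where the factor v = -w divided by
    the speed w is -1.\<close>
  define \<Psi> where "\<Psi> = (\<lambda>x. cp * \<phi> (x, w x) - cm * \<phi> (x, - w x))"
  have c\<phi>: "continuous_on UNIV \<phi>"
    using D by (auto intro!: continuous_at_imp_continuous_on has_derivative_continuous)
  have "continuous_on {a..b} w"
    unfolding w_def by (intro continuous_intros U_cont)
  then have c\<Psi>: "continuous_on {a..b} \<Psi>"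
    unfolding \<Psi>_def by (intro continuous_intros continuous_on_compose2[OF c\<phi>]) auto
  have d\<phi>: "((\<lambda>x. \<phi> (x, g x)) has_real_derivative \<phi>x (x, g x) + g' * \<phi>v (x, g x)) (at x)"
    if "(g has_real_derivative g') (at x)" for g g' x
  proof -
    have "((\<lambda>x. (x, g x)) has_derivative (\<lambda>e. (e, g' * e))) (at x)"
      using that by (intro has_derivative_Pair has_derivative_ident) (simp add: has_field_derivative_def)
    from has_derivative_compose[OF this D]
    show ?thesis
      unfolding has_field_derivative_def by (rule has_derivative_eq_rhs) (auto simp: algebra_simps)
  qed
  have "((\<lambda>x. energy_slice \<phi>x \<phi>v x h) has_integral \<Psi> b - \<Psi> a) {a..b}"
  proof (rule fundamental_theorem_of_calculus_interior[OF less_imp_le[OF ab] c\<Psi>])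
    fix x assume x: "x \<in> {a<..<b}"
    have Ux: "U x < h" using less[OF x] .
    then have wx: "w x > 0" by (simp add: w_def)
    have wx_eq: "sqrt (2 * (h - U x)) = w x" by (simp only: w_def)
    have d1: "(w has_real_derivative - U' x / w x) (at x)"
      using speed_derivative[OF Ux, of 1] by (simp add: w_def)
    have d2: "((\<lambda>x. - w x) has_real_derivative - (- U' x / w x)) (at x)"
      by (rule DERIV_minus[OF d1])
    have "(\<Psi> has_real_derivative
        cp * (\<phi>x (x, w x) + (- U' x / w x) * \<phi>v (x, w x))
        - cm * (\<phi>x (x, - w x) + (- (- U' x / w x)) * \<phi>v (x, - w x))) (at x)"
      unfolding \<Psi>_def by (intro DERIV_diff DERIV_cmult d\<phi> d1 d2)
    moreover have "energy_slice \<phi>x \<phi>v x h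
        = (cp * (w x * \<phi>x (x, w x) - U' x * \<phi>v (x, w x))
          + cm * (- w x * \<phi>x (x, - w x) - U' x * \<phi>v (x, - w x))) / w x"
      unfolding energy_slice_def wx_eq transport_integrand_def f0_def
      using Ux wx fp[OF x] by simp
    moreover have "\<dots> = cp * (\<phi>x (x, w x) + (- U' x / w x) * \<phi>v (x, w x))
        - cm * (\<phi>x (x, - w x) + (- (- U' x / w x)) * \<phi>v (x, - w x))"
      using wx by (simp add: field_simps)
    ultimately show "(\<Psi> has_vector_derivative energy_slice \<phi>x \<phi>v x h) (at x)"
      by (simp add: has_real_derivative_iff_has_vector_derivative)
  qed
  moreover have "\<Psi> e = 0" if e: "e \<in> {a, b}" for e
    using ends[OF e]
  proof
    assume *: "U e = h \<and> U' e \<noteq> 0 \<and> matching_limits e"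
    have "f m (sqrt (2 * (h - U m))) = f m (- sqrt (2 * (h - U m)))"
    proof (rule turning_point_match[OF lev])
      show "U z < h" if "z \<in> closed_segment m e" "z \<noteq> e" for z
        using that e m less[of z] by (auto simp: closed_segment_eq_real_ivl split: if_splits)
      show "m \<noteq> e" using m e by auto
    qed (use * in auto)
    then have "cp = cm" by (simp add: cp_def cm_def w_def)
    then show ?thesis using * by (simp add: \<Psi>_def w_def)
  next
    assume "\<forall>v. \<phi> (e, v) = 0"
    then show ?thesis by (simp add: \<Psi>_def)
  qed
  ultimately show ?thesis by simp
qed

lemma energy_slice_measurable:
  assumes "continuous_on UNIV \<phi>x" "continuous_on UNIV \<phi>v"
  shows "(\<lambda>p. energy_slice \<phi>x \<phi>v (fst p) (snd p)) \<in> borel_measurable borel"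
proof -
  let ?w = "\<lambda>p :: real \<times> real. sqrt (2 * (snd p - U (fst p)))"
  have cw: "continuous_on UNIV ?w"
    by (intro continuous_intros continuous_on_compose2[OF U_cont[of UNIV]]) auto
  have P: "transport_integrand \<phi>x \<phi>v \<in> borel_measurable borel"
    unfolding transport_integrand_def[abs_def] by (rule weak_integrand_measurable[OF assms])
  have Pc: "(\<lambda>p. transport_integrand \<phi>x \<phi>v (fst p, g p)) \<in> borel_measurable borel"
    if "continuous_on UNIV g" for g :: "real \<times> real \<Rightarrow> real"
    by (rule measurable_compose[OF borel_measurable_continuous_onI P])
      (intro continuous_intros that)
  have "open {p :: real \<times> real. U (fst p) < snd p}"
    by (intro open_Collect_less continuous_intros continuous_on_compose2[OF U_cont[of UNIV]]) auto
  then have set: "{p \<in> space borel. U (fst p) < snd p} \<in> sets (borel :: (real \<times> real) measure)"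
    by simp
  show ?thesis
    unfolding energy_slice_def
    by (intro measurable_If[OF _ _ set] borel_measurable_divide borel_measurable_add Pc
        borel_measurable_continuous_onI[OF cw] cw continuous_on_minus) auto
qed

text \<open>Two null sets of energies are discarded: the critical values, by Sard, and the image of
  the null set of points where the limits fail to match, which is null because \<open>U\<close> is
  differentiable.\<close>

lemma AE_regular_value:
  assumes "AE x in lebesgue. matching_limits x"
  shows "AE h in lborel. \<forall>x. U x = h \<longrightarrow> U' x \<noteq> 0 \<and> matching_limits x"
proof -
  obtain N where N: "N \<in> null_sets lebesgue" "{x. \<not> matching_limits x} \<subseteq> N"
    using assms by (auto simp: eventually_ae_filter)
  have "negligible (U ` {x. U' x = 0})"
  proof (rule negligible_critical_values)
    show "(U has_real_derivative 0) (at x)" if "x \<in> {x. U' x = 0}" for x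
      using U_deriv[of x] that by simp
  qed
  moreover have "negligible (U ` N)"
  proof (rule negligible_differentiable_image_negligible[OF order_refl])
    show "negligible N" using N(1) by (simp add: negligible_iff_null_sets)
    show "U differentiable_on N"
      using U_deriv by (meson differentiable_at_imp_differentiable_on real_differentiable_def)
  qed
  ultimately have "U ` {x. U' x = 0} \<union> U ` N \<in> null_sets lebesgue"
    by (simp add: negligible_Un flip: negligible_iff_null_sets)
  then have "AE h in lebesgue. h \<notin> U ` {x. U' x = 0} \<union> U ` N"
    by (rule AE_not_in)
  then have "AE h in lborel. h \<notin> U ` {x. U' x = 0} \<union> U ` N"
    by (simp only: AE_completion_iff)
  then show ?thesis
    by eventually_elim (use N(2) in blast)
qed

lemma energy_slice_integral_eq_0:
  assumes lev: constant_on_levels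
    and D: "\<And>p. (\<phi> has_derivative (\<lambda>e. fst e * \<phi>x p + snd e * \<phi>v p)) (at p)"
    and z: "\<And>p. \<bar>fst p\<bar> \<ge> M \<Longrightarrow> \<phi> p = 0" "\<And>p. \<bar>fst p\<bar> > M \<Longrightarrow> \<phi>x p = 0 \<and> \<phi>v p = 0"
    and reg: "\<And>x. U x = h \<Longrightarrow> U' x \<noteq> 0 \<and> matching_limits x"
    and int: "integrable lborel (\<lambda>x. energy_slice \<phi>x \<phi>v x h)"
  shows "(LINT x|lborel. energy_slice \<phi>x \<phi>v x h) = 0"
proof -
  let ?Q = "\<lambda>x. energy_slice \<phi>x \<phi>v x h"
  \<comment> \<open>The sublevel set may be unbounded, so it is cut off beyond the support. The
    margin 1 puts the added endpoints, and everything removed, strictly beyond \<open>M\<close>,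
    where the partial derivatives vanish.\<close>
  define A where "A = {- (M + 1)<..<M + 1} \<inter> {x. U x < h}"
  have oA: "open A"
    unfolding A_def by (intro open_Int open_Collect_less continuous_intros U_cont)
  have bA: "bounded A"
    unfolding A_def by (rule bounded_subset[OF bounded_closed_interval[of "- (M + 1)" "M + 1"]]) auto
  have "?Q x = 0" if "x \<notin> A" for x
    using that z(2)[of "(x, _)"] by (auto simp: A_def energy_slice_def transport_integrand_def)
  then have ind: "(\<lambda>x. indicator A x *\<^sub>R ?Q x) = ?Q"
    by (force simp: indicator_def)
  then have si: "set_integrable lborel A ?Q"
    using int by (simp add: set_integrable_def)
  have "(LINT x:A|lborel. ?Q x) = 0"
  proof (rule integral_components_eq_0[OF oA si])
    fix C assume C: "C \<in> components A"
    obtain a b where ab: "a < b" "C = {a<..<b}" "a \<notin> A" "b \<notin> A"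
      by (rule bounded_open_component_interval[OF oA bA C])
    have CA: "C \<subseteq> A" using C in_components_subset by blast
    have "((\<lambda>x. ?Q x) has_integral 0) {a..b}"
    proof (rule energy_slice_integral_component[OF lev ab(1) D])
      show "U x < h" if "x \<in> {a<..<b}" for x
        using that CA ab(2) by (auto simp: A_def)
      fix e assume e: "e \<in> {a, b}"
      show "(U e = h \<and> U' e \<noteq> 0 \<and> matching_limits e) \<or> (\<forall>v. \<phi> (e, v) = 0)"
      proof (cases "\<bar>e\<bar> \<ge> M")
        case True
        then show ?thesis using z(1) by simp
      next
        case False
        \<comment> \<open>Such an \<open>e\<close> is inside the cut-off interval, so only the
          condition on \<open>U\<close> can keep it out of \<open>A\<close>; being a limit of points
          of the sublevel set then makes it a turning point.\<close>
        then have "U e \<ge> h" using e ab(3,4) by (auto simp: A_def)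
        moreover have "e \<in> closure {x. U x < h}"
          using closure_mono[of "{a<..<b}" "{x. U x < h}"] CA ab e
          by (auto simp: A_def closure_greaterThanLessThan)
        then have "U e \<le> h"
          using closure_minimal[of "{x. U x < h}" "{x. U x \<le> h}"]
          by (force intro: closed_Collect_le U_cont)
        ultimately show ?thesis using reg by force
      qed
    qed
    from integral_unique[OF this] have "integral C ?Q = 0"
      unfolding ab(2) by (simp add: integral_open_interval_real)
    moreover have "set_integrable lborel C ?Q"
      by (rule set_integrable_subset[OF si _ CA]) (simp add: ab(2))
    ultimately show "(LINT x:C|lborel. ?Q x) = 0"
      using set_borel_integral_eq_integral(2) by metis
  qed simp
  then show ?thesis unfolding set_lebesgue_integral_def ind .
qed

lemma constant_on_levels_weak_solution:
  assumes lev: constant_on_levels and ml: "AE x in lebesgue. matching_limits x"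
  shows weak_solution
  unfolding weak_solution_def
proof (intro allI impI)
  fix \<phi> \<phi>x \<phi>v :: "real \<times> real \<Rightarrow> real" and M :: real
  assume D: "\<forall>p. (\<phi> has_derivative (\<lambda>e. fst e * \<phi>x p + snd e * \<phi>v p)) (at p)"
    and c: "continuous_on UNIV \<phi>x" "continuous_on UNIV \<phi>v"
    and z: "\<forall>p. \<bar>fst p\<bar> \<ge> M \<or> \<bar>snd p\<bar> \<ge> M \<longrightarrow> \<phi> p = 0"
      "\<forall>p. \<bar>fst p\<bar> > M \<or> \<bar>snd p\<bar> > M \<longrightarrow> \<phi>x p = 0 \<and> \<phi>v p = 0"
  let ?P = "transport_integrand \<phi>x \<phi>v" and ?Q = "energy_slice \<phi>x \<phi>v"
  have P: "integrable (lborel \<Otimes>\<^sub>M lborel) ?P"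
    unfolding lborel_prod transport_integrand_def[abs_def]
    by (rule weak_integrable[OF c]) (use z in blast)+
  have Qm: "(\<lambda>p. ?Q (fst p) (snd p)) \<in> borel_measurable (lborel \<Otimes>\<^sub>M lborel)"
    using energy_slice_measurable[OF c] by (simp add: lborel_prod)
  have sub: "integrable lborel (?Q x)" "(LINT h|lborel. ?Q x h) = (LINT v|lborel. ?P (x, v))"
    "(LINT h|lborel. \<bar>?Q x h\<bar>) \<le> (LINT v|lborel. \<bar>?P (x, v)\<bar>)"
    if "integrable lborel (\<lambda>v. ?P (x, v))" for x
    using energy_substitution[OF that, where c = "U x"]
    by (simp_all add: energy_slice_def[abs_def] transport_integrand_def f0_def)
  have AEx: "AE x in lborel. integrable lborel (\<lambda>v. ?P (x, v))"
    by (rule lborel_pair.AE_integrable_fst'[OF P])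
  \<comment> \<open>Absolute integrability over the plane, inherited from the weak integrand through
    the L^1 bound \<open>sub(3)\<close>; it permits integrating in \<open>x\<close> first.\<close>
  have Qint: "integrable (lborel \<Otimes>\<^sub>M lborel) (\<lambda>p. ?Q (fst p) (snd p))"
  proof (rule lborel_pair.Fubini_integrable[OF Qm])
    show "AE x in lborel. integrable lborel (\<lambda>h. ?Q (fst (x, h)) (snd (x, h)))"
      using AEx by eventually_elim (simp add: sub(1))
    have "integrable lborel (\<lambda>x. LINT v|lborel. \<bar>?P (x, v)\<bar>)"
      using lborel_pair.integrable_fst'[OF integrable_abs[OF P]] .
    then show "integrable lborel (\<lambda>x. LINT h|lborel. norm (?Q (fst (x, h)) (snd (x, h))))"
    proof (rule Bochner_Integration.integrable_bound)
      show "(\<lambda>x. LINT h|lborel. norm (?Q (fst (x, h)) (snd (x, h)))) \<in> borel_measurable lborel"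
        using Qm by (intro lborel.borel_measurable_lebesgue_integral) (simp add: split_beta)
      show "AE x in lborel. norm (LINT h|lborel. norm (?Q (fst (x, h)) (snd (x, h))))
          \<le> norm (LINT v|lborel. \<bar>?P (x, v)\<bar>)"
        using AEx by eventually_elim (use sub(3) in force)
    qed
  qed
  have Qint': "integrable (lborel \<Otimes>\<^sub>M lborel) (\<lambda>(x, h). ?Q x h)"
    using Qint unfolding case_prod_beta' .
  have "(LINT p|lborel. ?P p) = (LINT x|lborel. LINT v|lborel. ?P (x, v))"
    using lborel_pair.integral_fst'[OF P] by (simp add: lborel_prod)
  also have "\<dots> = (LINT x|lborel. LINT h|lborel. ?Q x h)"
  proof (rule integral_cong_AE)
    show "(\<lambda>x. LINT v|lborel. ?P (x, v)) \<in> borel_measurable lborel"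
      using lborel_pair.integrable_fst'[OF P] by (rule borel_measurable_integrable)
    show "(\<lambda>x. LINT h|lborel. ?Q x h) \<in> borel_measurable lborel"
      using lborel_pair.integrable_fst'[OF Qint] by (auto dest: borel_measurable_integrable)
    show "AE x in lborel. (LINT v|lborel. ?P (x, v)) = (LINT h|lborel. ?Q x h)"
      using AEx by eventually_elim (simp add: sub(2))
  qed
  also have "\<dots> = (LINT h|lborel. LINT x|lborel. ?Q x h)"
    using lborel_pair.Fubini_integral[OF Qint'] by simp
  also have "\<dots> = (LINT h|(lborel :: real measure). (0 :: real))"
  proof (rule integral_cong_AE)
    show "(\<lambda>h. LINT x|lborel. ?Q x h) \<in> borel_measurable lborel"
      using lborel_pair.integrable_snd[OF Qint'] by (rule borel_measurable_integrable)
    show "AE h in lborel. (LINT x|lborel. ?Q x h) = 0"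
      using AE_regular_value[OF ml] lborel_pair.AE_integrable_snd[OF Qint']
    proof eventually_elim
      fix h assume "\<forall>x. U x = h \<longrightarrow> U' x \<noteq> 0 \<and> matching_limits x" "integrable lborel (\<lambda>x. ?Q x h)"
      then show "(LINT x|lborel. ?Q x h) = 0"
        using energy_slice_integral_eq_0[OF lev, of \<phi> \<phi>x \<phi>v M h] D z by blast
    qed
  qed simp
  finally show "(LINT p|lborel. f0 p * (snd p * \<phi>x p - U' (fst p) * \<phi>v p)) = 0"
    by (simp add: transport_integrand_def)
qed

end

section \<open>Enumerated components\<close>

lemma component_index_mem:
  assumes "enumerates_components A I E" "x \<in> A h"
  shows "component_index I E x h \<in> I h" and "x \<in> E h (component_index I E x h)"
  using theI'[OF component_index_unique[OF assms]] unfolding component_index_def by auto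

lemma enumerated_component:
  assumes "enumerates_components A I E" "k \<in> I h"
  shows "E h k \<in> components (A h)"
  using assms unfolding enumerates_components_def by (metis bij_betwE)

lemma closed_segment_subset_component:
  fixes A :: "real \<Rightarrow> real set"
  assumes "enumerates_components A I E" "k \<in> I h" "x \<in> E h k" "y \<in> E h k"
  shows "closed_segment x y \<subseteq> A h"
proof -
  have C: "E h k \<in> components (A h)" by (rule enumerated_component[OF assms(1,2)])
  have "convex (E h k)"
    using in_components_connected[OF C] by (simp add: is_interval_connected_1 flip: is_interval_convex_1)
  then show ?thesis
    using closed_segment_subset[OF assms(3,4)] in_components_subset[OF C] by blast
qed

text \<open>A segment is connected, so by maximality it stays in a single component. Together with
  \<open>closed_segment_subset_component\<close> this translates between indices and the segments in
  \<open>constant_on_levels\<close>.\<close>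

lemma component_index_eq:
  assumes en: "enumerates_components A I E" and seg: "closed_segment x y \<subseteq> A h"
  shows "component_index I E x h = component_index I E y h"
proof -
  let ?k = "component_index I E x h"
  have xA: "x \<in> A h" and yA: "y \<in> A h" using seg by auto
  note k = component_index_mem[OF en xA]
  have "closed_segment x y \<subseteq> E h ?k"
    by (rule components_maximal[OF enumerated_component[OF en k(1)] connected_segment(1) seg]) (use k(2) in auto)
  then have "y \<in> E h ?k" by auto
  then show ?thesis
    using component_index_unique[OF en yA] component_index_mem[OF en yA] k(1) by blast
qed

text \<open>For condition (ii), in which both integrals run over v > 0. The value of
  \<open>g\<close> at 0 is arbitrary, so the splitting holds only almost everywhere.\<close>

lemma integral_split_reflect:
  fixes g :: "real \<Rightarrow> real"
  assumes g: "integrable lebesgue g"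
  shows "(LINT v|lebesgue. g v) = (LINT v:{0<..}|lebesgue. g v) + (LINT v:{0<..}|lebesgue. g (- v))"
proof -
  have si: "set_integrable lebesgue {0<..} g" "set_integrable lebesgue {..<0} g"
    using integrable_mult_indicator[OF _ g] unfolding set_integrable_def by auto
  have "(LINT v|lebesgue. g v) = (LINT v:{0<..} \<union> {..<0}|lebesgue. g v)"
    unfolding set_lebesgue_integral_def
  proof (rule integral_cong_AE)
    have "AE v in lebesgue. v \<noteq> (0 :: real)"
      by (rule AE_completion[OF AE_lborel_singleton])
    then show "AE v in lebesgue. g v = indicator ({0<..} \<union> {..<0}) v *\<^sub>R g v"
      by eventually_elim (auto simp: indicator_def)
    show "(\<lambda>v. indicator ({0<..} \<union> {..<0}) v *\<^sub>R g v) \<in> borel_measurable lebesgue"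
      by (rule borel_measurable_integrable[OF integrable_mult_indicator[OF _ g]]) simp
  qed (use g in simp)
  also have "\<dots> = (LINT v:{0<..}|lebesgue. g v) + (LINT v:{..<0}|lebesgue. g v)"
    by (rule set_integral_Un) (use si in auto)
  also have "(LINT v:{..<0}|lebesgue. g v) = (LINT v:{0<..}|lebesgue. g (- v))"
  proof -
    have "(\<lambda>v. indicator {..<0} (0 + - 1 * v) *\<^sub>R g (0 + - 1 * v)) = (\<lambda>v. indicator {0<..} v *\<^sub>R g (- v))"
      by (auto simp: indicator_def)
    then show ?thesis
      using lebesgue_integral_real_affine[of "-1" "\<lambda>v. indicator {..<0} v *\<^sub>R g v" 0]
      unfolding set_lebesgue_integral_def by simp
  qed
  finally show ?thesis .
qed

theorem proposition5p2:
  fixes R :: real and \<Phi> :: "real \<Rightarrow> real" and f :: "real \<Rightarrow> real \<Rightarrow> real"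
    and I :: "real \<Rightarrow> nat set" and E :: "real \<Rightarrow> nat \<Rightarrow> real set"
  defines "H \<equiv> hamiltonian \<Phi> f"
    and "K \<equiv> component_index I E"
  assumes "R > 0"
    and "real_analytic_power_series R \<Phi>"
    and "L1_loc (\<lambda>(x, v). f x v)"
    and "Ck_on 1 ({(x, v). v < 0} \<union> {(x, v). v > 0}) (\<lambda>(x, v). f x v)"
    and "\<And>x. integrable lebesgue (f x)"
    and "rho f C1_differentiable_on UNIV"
    and "\<And>x. rho f x \<in> {-R<..<R}"
    and "enumerates_components (sublevel \<Phi> f) I E"
  shows "weak_stationary_state \<Phi> f \<longleftrightarrow>
    (\<exists>F G :: nat \<Rightarrow> real \<Rightarrow> real.
       (\<forall>x. (\<forall>v>0. f x v = F (K x (H x v)) (H x v)) \<and>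
            (\<forall>v<0. f x v = G (K x (H x v)) (H x v))) \<and>
       (\<forall>x. rho f x = (LINT v:{0<..}|lebesgue. F (K x (H x v)) (H x v))
                    + (LINT v:{0<..}|lebesgue. G (K x (H x v)) (H x v))) \<and>
       (AE x in lebesgue. \<exists>L.
          ((\<lambda>v. deriv (potential \<Phi> f) x * F (K x (H x v)) (H x v)) \<longlongrightarrow> L) (at_right 0) \<and>
          ((\<lambda>v. deriv (potential \<Phi> f) x * G (K x (H x v)) (H x v)) \<longlongrightarrow> L) (at_left 0)))"
proof -
  note en = assms(10)
  define U where "U = potential \<Phi> f"
  obtain U' where U': "\<And>x. (U has_real_derivative U' x) (at x)" "continuous_on UNIV U'"
    unfolding U_def by (rule potential_C1[OF assms(4,8,9)]) blast
  interpret phase_space f U U'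
    by unfold_locales (use U' assms(5-7) in auto)
  have dU: "deriv (potential \<Phi> f) x = U' x" for x
    using DERIV_imp_deriv[OF U'(1)] by (simp add: U_def)
  have Hx: "H x v = v\<^sup>2 / 2 + U x" for x v
    by (simp add: H_def hamiltonian_def U_def)
  have sub: "sublevel \<Phi> f h = {x. U x < h}" for h
    by (simp add: sublevel_def U_def)
  \<comment> \<open>One-sided limits at v = 0 see only nonzero v of one sign, where (i) identifies
    \<open>f\<close> with \<open>F\<close> or \<open>G\<close>.\<close>
  have matching_iff: "matching_limits x \<longleftrightarrow> (\<exists>L.
          ((\<lambda>v. deriv (potential \<Phi> f) x * F (K x (H x v)) (H x v)) \<longlongrightarrow> L) (at_right 0) \<and>
          ((\<lambda>v. deriv (potential \<Phi> f) x * G (K x (H x v)) (H x v)) \<longlongrightarrow> L) (at_left 0))"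
    if "\<And>x v. v > 0 \<Longrightarrow> f x v = F (K x (H x v)) (H x v)" "\<And>x v. v < 0 \<Longrightarrow> f x v = G (K x (H x v)) (H x v)"
    for x F G
  proof -
    have "((\<lambda>v. U' x * f x v) \<longlongrightarrow> L) (at_right 0) \<longleftrightarrow> ((\<lambda>v. U' x * F (K x (H x v)) (H x v)) \<longlongrightarrow> L) (at_right 0)"
      "((\<lambda>v. U' x * f x v) \<longlongrightarrow> L) (at_left 0) \<longleftrightarrow> ((\<lambda>v. U' x * G (K x (H x v)) (H x v)) \<longlongrightarrow> L) (at_left 0)" for L
      by (rule tendsto_cong; use that in \<open>auto simp: eventually_at_filter\<close>)+
    then show ?thesis by (simp add: matching_limits_def dU)
  qed
  show ?thesis
  proof
    assume "weak_stationary_state \<Phi> f"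
    then have w: weak_solution
      using weak_stationary_state_iff[of \<Phi>] by (simp add: U_def)
    have lev: constant_on_levels
      by (rule transport_constant_on_levels[OF weak_solution_transport[OF w]])
    \<comment> \<open>Any point of a component can serve as its representative, since
      \<open>f\<close> is constant along the component at fixed energy and sign. For indices that
      enumerate no component the choice is arbitrary and never evaluated.\<close>
    define base where "base = (\<lambda>k h. SOME y. y \<in> E h k)"
    define F where "F = (\<lambda>k h. f (base k h) (sqrt (2 * (h - U (base k h)))))"
    define G where "G = (\<lambda>k h. f (base k h) (- sqrt (2 * (h - U (base k h)))))"
    have rep: "f x v = f (base (K x (H x v)) (H x v)) (sgn v * sqrt (2 * (H x v - U (base (K x (H x v)) (H x v)))))"
      if "v \<noteq> 0" for x v
    proof -
      let ?y = "base (K x (H x v)) (H x v)"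
      have "x \<in> sublevel \<Phi> f (H x v)" using that by (simp add: sub Hx)
      note k = component_index_mem[OF en this, folded K_def]
      have "?y \<in> E (H x v) (K x (H x v))"
        unfolding base_def by (rule someI[of "\<lambda>y. y \<in> E (H x v) (K x (H x v))", OF k(2)])
      then have "closed_segment x ?y \<subseteq> sublevel \<Phi> f (H x v)"
        by (rule closed_segment_subset_component[OF en k])
      then have "U z < v\<^sup>2 / 2 + U x" if "z \<in> closed_segment x ?y" for z
        using that by (auto simp: sub Hx)
      from constant_on_levelsD[OF lev that this]
      show ?thesis by (simp add: Hx)
    qed
    have fF: "f x v = F (K x (H x v)) (H x v)" if "v > 0" for x v
      using rep[of v x] that by (simp add: F_def)
    have fG: "f x v = G (K x (H x v)) (H x v)" if "v < 0" for x v
      using rep[of v x] that by (simp add: G_def)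
    have "rho f x = (LINT v:{0<..}|lebesgue. F (K x (H x v)) (H x v))
                  + (LINT v:{0<..}|lebesgue. G (K x (H x v)) (H x v))" for x
    proof -
      have "rho f x = (LINT v:{0<..}|lebesgue. f x v) + (LINT v:{0<..}|lebesgue. f x (- v))"
        unfolding rho_def by (rule integral_split_reflect[OF assms(7)])
      also have "(LINT v:{0<..}|lebesgue. f x v) = (LINT v:{0<..}|lebesgue. F (K x (H x v)) (H x v))"
        by (rule set_lebesgue_integral_cong) (auto simp: fF)
      \<comment> \<open>The energy is even in v, so the reflected integrand has the same energy and
        the same component.\<close>
      also have "(LINT v:{0<..}|lebesgue. f x (- v)) = (LINT v:{0<..}|lebesgue. G (K x (H x v)) (H x v))"
        by (rule set_lebesgue_integral_cong) (auto simp: fG Hx)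
      finally show ?thesis .
    qed
    moreover have "AE x in lebesgue. \<exists>L.
          ((\<lambda>v. deriv (potential \<Phi> f) x * F (K x (H x v)) (H x v)) \<longlongrightarrow> L) (at_right 0) \<and>
          ((\<lambda>v. deriv (potential \<Phi> f) x * G (K x (H x v)) (H x v)) \<longlongrightarrow> L) (at_left 0)"
      using weak_solution_matching_limits[OF w] matching_iff[OF fF fG] by simp
    ultimately show "\<exists>F G :: nat \<Rightarrow> real \<Rightarrow> real.
       (\<forall>x. (\<forall>v>0. f x v = F (K x (H x v)) (H x v)) \<and>
            (\<forall>v<0. f x v = G (K x (H x v)) (H x v))) \<and>
       (\<forall>x. rho f x = (LINT v:{0<..}|lebesgue. F (K x (H x v)) (H x v))
                    + (LINT v:{0<..}|lebesgue. G (K x (H x v)) (H x v))) \<and>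
       (AE x in lebesgue. \<exists>L.
          ((\<lambda>v. deriv (potential \<Phi> f) x * F (K x (H x v)) (H x v)) \<longlongrightarrow> L) (at_right 0) \<and>
          ((\<lambda>v. deriv (potential \<Phi> f) x * G (K x (H x v)) (H x v)) \<longlongrightarrow> L) (at_left 0))"
      using fF fG by blast
  next
    assume "\<exists>F G :: nat \<Rightarrow> real \<Rightarrow> real.
       (\<forall>x. (\<forall>v>0. f x v = F (K x (H x v)) (H x v)) \<and>
            (\<forall>v<0. f x v = G (K x (H x v)) (H x v))) \<and>
       (\<forall>x. rho f x = (LINT v:{0<..}|lebesgue. F (K x (H x v)) (H x v))
                    + (LINT v:{0<..}|lebesgue. G (K x (H x v)) (H x v))) \<and>
       (AE x in lebesgue. \<exists>L.
          ((\<lambda>v. deriv (potential \<Phi> f) x * F (K x (H x v)) (H x v)) \<longlongrightarrow> L) (at_right 0) \<and>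
          ((\<lambda>v. deriv (potential \<Phi> f) x * G (K x (H x v)) (H x v)) \<longlongrightarrow> L) (at_left 0))"
    then obtain F G :: "nat \<Rightarrow> real \<Rightarrow> real" where
      fF: "\<And>x v. v > 0 \<Longrightarrow> f x v = F (K x (H x v)) (H x v)" and
      fG: "\<And>x v. v < 0 \<Longrightarrow> f x v = G (K x (H x v)) (H x v)" and
      lim: "AE x in lebesgue. \<exists>L.
          ((\<lambda>v. deriv (potential \<Phi> f) x * F (K x (H x v)) (H x v)) \<longlongrightarrow> L) (at_right 0) \<and>
          ((\<lambda>v. deriv (potential \<Phi> f) x * G (K x (H x v)) (H x v)) \<longlongrightarrow> L) (at_left 0)"
      by blast
    have "AE x in lebesgue. matching_limits x"
      using lim matching_iff[OF fF fG] by simp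
    moreover have constant_on_levels
      unfolding constant_on_levels_def
    proof (intro ballI allI impI)
      fix s x y h :: real assume s: "s \<in> {-1, 1}" and less: "\<forall>z\<in>closed_segment x y. U z < h"
      have K: "K x h = K y h"
        unfolding K_def by (rule component_index_eq[OF en]) (use less in \<open>auto simp: sub\<close>)
      \<comment> \<open>The velocity is chosen so that its energy at \<open>z\<close> is exactly
        \<open>h\<close>; its sign \<open>s\<close> selects the profile. Only the index could then
        still depend on the point, and \<open>K\<close> excludes that.\<close>
      have f: "f z (s * sqrt (2 * (h - U z))) = (if s = 1 then F (K z h) h else G (K z h) h)" if "U z < h" for z
      proof -
        have "(s * sqrt (2 * (h - U z)))\<^sup>2 = 2 * (h - U z)"
          using s that by (auto simp: power_mult_distrib)
        then have "H z (s * sqrt (2 * (h - U z))) = h" by (simp add: Hx diff_divide_distrib)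
        moreover have "sqrt (2 * (h - U z)) > 0" using that by simp
        ultimately show ?thesis
          using fF[of "s * sqrt (2 * (h - U z))" z] fG[of "s * sqrt (2 * (h - U z))" z] s by auto
      qed
      show "f x (s * sqrt (2 * (h - U x))) = f y (s * sqrt (2 * (h - U y)))"
        using f[of x] f[of y] less K by simp
    qed
    ultimately have weak_solution
      by (rule constant_on_levels_weak_solution[rotated])
    then show "weak_stationary_state \<Phi> f"
      using weak_stationary_state_iff[of \<Phi>] by (simp add: U_def)
  qed
qed

end
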